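(* Let $X$ be a proper geodesic Gromov hyperbolic space. Suppose there exist a geodesically rich Gromov hyperbolic space $Y$ and a quasi-isometric embedding $f:X\to Y$ whose induced map $\partial f:\partial X\to\partial Y$ is a bijection. Then $X$ is boundary rigid and $\partial X$ is uniformly perfect.
   Context: Quasi-isometries: a map $f:(X,d)\to(Y,d')$ is a $(K,C)$-quasi-isometric embedding ($K\ge 1$, $C\ge 0$) if $K^{-1}d(x,y)-C\le d'(f(x),f(y))\le Kd(x,y)+C$ for all $x,y\in X$; it is a $(K,C)$-quasi-isometry if in addition every point of $Y$ is within distance $C$ of $f(X)$; a quasi-isometry (quasi-isometric embedding) is one for some $K,C$. Hyperbolicity: a geodesic metric space $X$ is $\delta$-hyperbolic if each side of every geodesic triangle lies in the closed $\delta$-neighborhood of the other two sides; Gromov hyperbolic means $\delta$-hyperbolic for some $\delta\ge0$. For a base point $w\in X$, $(x|y)_w=\frac12(d(x,w)+d(y,w)-d(x,y))$. A sequence $\{x_i\}$ is a Gromov sequence if $(x_i|x_j)_w\to\infty$ as $i,j\to\infty$; two Gromov sequences are equivalent if $(x_i|y_i)_w\to\infty$. $\partial X$ is the set of equivalence classes. A quasi-isometric embedding $f:X\to Y$ between geodesic hyperbolic spaces induces $\partial f:\partial X\to\partial Y$, $[\{x_i\}]\mapsto[\{f(x_i)\}]$. Boundary rigid: every quasi-isometry $f:X\to X$ with $\partial f=\mathrm{id}_{\partial X}$ satisfies $\sup_{x\in X}d(x,f(x))<\infty$. Visual metric: $(\xi|\zeta)_w=\inf\{\liminf_i (x_i|y_i)_w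 : \{x_i\}\in\xi,\{y_i\}\in\zeta\}$ for $\xi,\zeta\in\partial X$. If $X$ is $\delta$-hyperbolic with $\delta>0$ (enlarged if necessary so that geodesic triangles are also $\delta$-thin) and $0<\varepsilon<\min\{1,\frac1{5\delta}\}$, then $d_{w,\varepsilon}(\xi,\zeta)=\inf\sum_{i=1}^n e^{-\varepsilon(\xi_{i-1}|\xi_i)_w}$ over finite chains $\xi=\xi_0,\dots,\xi_n=\zeta$ in $\partial X$. Uniformly perfect: $(Z,d)$ is uniformly perfect if there are $S\ge1$, $r_0>0$ such that for each $x\in Z$ and $0<r\le r_0$ there is $y\in Z$ with $r/S<d(x,y)\le r$. "$\partial X$ is uniformly perfect" refers to a visual metric and does not depend on its choice. Geodesically rich: a geodesic metric space $(X,d)$ is geodesically rich if there are constants $r_0,r_1,r_2,r_3,r_4$ such that (i) for every pair of points $p,q\in X$ with $d(p,q)\ge r_0$ there is a bi-infinite geodesic $\gamma$ with $d(p,\gamma)<r_1$ and $|d(q,\gamma)-d(p,q)|<r_2$; and (ii) for any bi-infinite geodesic $\gamma$ and any $p\in X$ there is a bi-infinite geodesic $\gamma'$ with $d(p,\gamma')<r_3$ and $|d(p,\gamma)-d(\gamma',\gamma)|<r_4$. A bi-infinite geodesic is (the image of) an isometric embedding $\mathbb R\to X$, and distances to or between sets are infima. *)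

theory Defs
  imports "HOL-Analysis.Analysis"
begin

text \<open>A metric space is a type of class \<^class>\<open>metric_space\<close>; properties of a whole space are
  predicates on \<open>TYPE('a)\<close>.\<close>

subsection \<open>Proper, geodesic and hyperbolic spaces\<close>

definition proper_metric_space :: "'a::metric_space itself \<Rightarrow> bool" where
  "proper_metric_space _ \<longleftrightarrow> (\<forall>(x::'a) r. compact (cball x r))"

definition geodesic_segment :: "'a::metric_space set \<Rightarrow> 'a \<Rightarrow> 'a \<Rightarrow> bool" where
  "geodesic_segment A x y \<longleftrightarrow>
     (\<exists>g::real \<Rightarrow> 'a. g 0 = x \<and> g (dist x y) = y \<and>
        (\<forall>s\<in>{0..dist x y}. \<forall>t\<in>{0..dist x y}. dist (g s) (g t) = \<bar>s - t\<bar>) \<and>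
        A = g ` {0..dist x y})"

definition geodesic_space :: "'a::metric_space itself \<Rightarrow> bool" where
  "geodesic_space _ \<longleftrightarrow> (\<forall>x y::'a. \<exists>A. geodesic_segment A x y)"

definition closed_nbhd :: "real \<Rightarrow> 'a::metric_space set \<Rightarrow> 'a set" where
  "closed_nbhd \<delta> S = {p. infdist p S \<le> \<delta>}"

definition delta_hyperbolic :: "'a::metric_space itself \<Rightarrow> real \<Rightarrow> bool" where
  "delta_hyperbolic T \<delta> \<longleftrightarrow> geodesic_space T \<and>
     (\<forall>(x::'a) y z A B C.
        geodesic_segment A x y \<longrightarrow> geodesic_segment B y z \<longrightarrow> geodesic_segment C z x \<longrightarrow>
          A \<subseteq> closed_nbhd \<delta> (B \<union> C) \<and>
          B \<subseteq> closed_nbhd \<delta> (C \<union> A) \<and>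
          C \<subseteq> closed_nbhd \<delta> (A \<union> B))"

definition gromov_hyperbolic :: "'a::metric_space itself \<Rightarrow> bool" where
  "gromov_hyperbolic T \<longleftrightarrow> (\<exists>\<delta>\<ge>0. delta_hyperbolic T \<delta>)"

definition gromov_prod :: "'a::metric_space \<Rightarrow> 'a \<Rightarrow> 'a \<Rightarrow> real" where
  "gromov_prod w x y = (dist x w + dist y w - dist x y) / 2"

text \<open>A geodesic triangle is \<open>\<delta>\<close>-thin if the fibres of its comparison map to a tripod have
  diameter at most \<open>\<delta>\<close>. Two points on different sides lie in the same fibre iff they are at the
  same distance from the common vertex \<open>x\<close> of these sides and that distance is at most the Gromov
  product at \<open>x\<close> of the other two vertices. The third side plays no role.\<close>

definition delta_thin_triangles :: "'a::metric_space itself \<Rightarrow> real \<Rightarrow> bool" where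
  "delta_thin_triangles _ \<delta> \<longleftrightarrow>
     (\<forall>(x::'a) y z A B. geodesic_segment A x y \<longrightarrow> geodesic_segment B x z \<longrightarrow>
        (\<forall>p\<in>A. \<forall>q\<in>B. dist x p = dist x q \<and> dist x p \<le> gromov_prod x y z \<longrightarrow> dist p q \<le> \<delta>))"

subsection \<open>Quasi-isometries\<close>

definition qi_embedding_with ::
    "real \<Rightarrow> real \<Rightarrow> ('a::metric_space \<Rightarrow> 'b::metric_space) \<Rightarrow> bool" where
  "qi_embedding_with K C f \<longleftrightarrow> K \<ge> 1 \<and> C \<ge> 0 \<and>
     (\<forall>x y. dist x y / K - C \<le> dist (f x) (f y) \<and> dist (f x) (f y) \<le> K * dist x y + C)"

definition quasi_isometry_with ::
    "real \<Rightarrow> real \<Rightarrow> ('a::metric_space \<Rightarrow> 'b::metric_space) \<Rightarrow> bool" where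
  "quasi_isometry_with K C f \<longleftrightarrow>
     qi_embedding_with K C f \<and> (\<forall>y. infdist y (range f) \<le> C)"

definition quasi_isometric_embedding :: "('a::metric_space \<Rightarrow> 'b::metric_space) \<Rightarrow> bool" where
  "quasi_isometric_embedding f \<longleftrightarrow> (\<exists>K C. qi_embedding_with K C f)"

definition quasi_isometry :: "('a::metric_space \<Rightarrow> 'b::metric_space) \<Rightarrow> bool" where
  "quasi_isometry f \<longleftrightarrow> (\<exists>K C. quasi_isometry_with K C f)"

subsection \<open>The Gromov boundary\<close>

text \<open>Changing the base point changes Gromov products by a bounded amount only, so the two notions
  below do not depend on it; quantifying over all base points avoids choosing one.\<close>

definition gromov_sequence :: "(nat \<Rightarrow> 'a::metric_space) \<Rightarrow> bool" where
  "gromov_sequence x \<longleftrightarrow>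
     (\<forall>w. filterlim (\<lambda>(i, j). gromov_prod w (x i) (x j)) at_top (sequentially \<times>\<^sub>F sequentially))"

definition gromov_equiv :: "((nat \<Rightarrow> 'a::metric_space) \<times> (nat \<Rightarrow> 'a)) set" where
  "gromov_equiv = {(x, y). gromov_sequence x \<and> gromov_sequence y \<and>
     (\<forall>w. filterlim (\<lambda>i. gromov_prod w (x i) (y i)) at_top sequentially)}"

definition gromov_boundary :: "'a::metric_space itself \<Rightarrow> (nat \<Rightarrow> 'a) set set" where
  "gromov_boundary _ = {x. gromov_sequence x} // gromov_equiv"

text \<open>The union runs over all representatives of the class \<open>\<xi>\<close>. If \<open>f\<close> is a quasi-isometric
  embedding between geodesic hyperbolic spaces, all of its members coincide with the class
  of \<open>f \<circ> x\<close>.\<close>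

definition boundary_map ::
    "('a::metric_space \<Rightarrow> 'b::metric_space) \<Rightarrow> (nat \<Rightarrow> 'a) set \<Rightarrow> (nat \<Rightarrow> 'b) set" where
  "boundary_map f \<xi> = (\<Union>x\<in>\<xi>. gromov_equiv `` {f \<circ> x})"

definition boundary_rigid :: "'a::metric_space itself \<Rightarrow> bool" where
  "boundary_rigid T \<longleftrightarrow>
     (\<forall>f::'a \<Rightarrow> 'a. quasi_isometry f \<and> (\<forall>\<xi>\<in>gromov_boundary T. boundary_map f \<xi> = \<xi>) \<longrightarrow>
        bdd_above (range (\<lambda>x. dist x (f x))))"

subsection \<open>Visual metrics and uniform perfectness\<close>

text \<open>The value is \<open>\<infinity>\<close> when \<open>\<xi> = \<zeta>\<close>, whence the extended reals and the case
  distinction \<open>e\<^sup>-\<^sup>\<infinity> = 0\<close> in \<open>visual_weight\<close>.\<close>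

definition boundary_gromov_prod ::
    "'a::metric_space \<Rightarrow> (nat \<Rightarrow> 'a) set \<Rightarrow> (nat \<Rightarrow> 'a) set \<Rightarrow> ereal" where
  "boundary_gromov_prod w \<xi> \<zeta> =
     (INF (x, y)\<in>\<xi> \<times> \<zeta>. liminf (\<lambda>i. ereal (gromov_prod w (x i) (y i))))"

definition visual_weight ::
    "'a::metric_space \<Rightarrow> real \<Rightarrow> (nat \<Rightarrow> 'a) set \<Rightarrow> (nat \<Rightarrow> 'a) set \<Rightarrow> real" where
  "visual_weight w \<epsilon> \<xi> \<zeta> =
     (if boundary_gromov_prod w \<xi> \<zeta> = \<infinity> then 0
      else exp (- \<epsilon> * real_of_ereal (boundary_gromov_prod w \<xi> \<zeta>)))"

definition visual_dist ::
    "'a::metric_space \<Rightarrow> real \<Rightarrow> (nat \<Rightarrow> 'a) set \<Rightarrow> (nat \<Rightarrow> 'a) set \<Rightarrow> real" where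
  "visual_dist w \<epsilon> \<xi> \<zeta> =
     Inf {\<Sum>i=1..n. visual_weight w \<epsilon> (c (i - 1)) (c i) | (n::nat) c.
            c 0 = \<xi> \<and> c n = \<zeta> \<and> (\<forall>i\<le>n. c i \<in> gromov_boundary TYPE('a))}"

definition visual_parameter :: "'a::metric_space itself \<Rightarrow> real \<Rightarrow> bool" where
  "visual_parameter T \<epsilon> \<longleftrightarrow>
     (\<exists>\<delta>>0. delta_hyperbolic T \<delta> \<and> delta_thin_triangles T \<delta> \<and> 0 < \<epsilon> \<and> \<epsilon> < min 1 (1 / (5 * \<delta>)))"

definition uniformly_perfect :: "'z set \<Rightarrow> ('z \<Rightarrow> 'z \<Rightarrow> real) \<Rightarrow> bool" where
  "uniformly_perfect Z d \<longleftrightarrow>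
     (\<exists>S\<ge>1. \<exists>r\<^sub>0>0. \<forall>x\<in>Z. \<forall>r. 0 < r \<and> r \<le> r\<^sub>0 \<longrightarrow> (\<exists>y\<in>Z. r / S < d x y \<and> d x y \<le> r))"

text \<open>Uniform perfectness of the boundary is independent of the visual metric; it is required here
  for every one of them.\<close>

definition uniformly_perfect_boundary :: "'a::metric_space itself \<Rightarrow> bool" where
  "uniformly_perfect_boundary T \<longleftrightarrow>
     (\<forall>(w::'a) \<epsilon>. visual_parameter T \<epsilon> \<longrightarrow>
        uniformly_perfect (gromov_boundary T) (visual_dist w \<epsilon>))"

subsection \<open>Geodesically rich spaces\<close>

definition bi_infinite_geodesic :: "'a::metric_space set \<Rightarrow> bool" where
  "bi_infinite_geodesic \<gamma> \<longleftrightarrow>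
     (\<exists>g::real \<Rightarrow> 'a. (\<forall>s t. dist (g s) (g t) = \<bar>s - t\<bar>) \<and> \<gamma> = range g)"

definition geodesically_rich :: "'a::metric_space itself \<Rightarrow> bool" where
  "geodesically_rich T \<longleftrightarrow> geodesic_space T \<and>
     (\<exists>r\<^sub>0 r\<^sub>1 r\<^sub>2 r\<^sub>3 r\<^sub>4::real.
        (\<forall>p q::'a. dist p q \<ge> r\<^sub>0 \<longrightarrow>
           (\<exists>\<gamma>. bi_infinite_geodesic \<gamma> \<and> infdist p \<gamma> < r\<^sub>1 \<and> \<bar>infdist q \<gamma> - dist p q\<bar> < r\<^sub>2)) \<and>
        (\<forall>\<gamma> (p::'a). bi_infinite_geodesic \<gamma> \<longrightarrow>
           (\<exists>\<gamma>'. bi_infinite_geodesic \<gamma>' \<and> infdist p \<gamma>' < r\<^sub>3 \<and>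
              \<bar>infdist p \<gamma> - setdist \<gamma>' \<gamma>\<bar> < r\<^sub>4)))"

end

theory Submission
  imports Defs
begin

text \<open>
  Both conclusions follow from one property of \<open>X\<close>, called coarse richness below. For points \<open>p\<close>,
  \<open>q\<close> at large distance there is a pair of boundary points such that geodesics joining them pass
  close to \<open>p\<close>, but stay at a distance from \<open>q\<close> that grows linearly with that between \<open>p\<close> and \<open>q\<close>.
  It is expressed by Gromov products \<open>(a\<^sub>n|b\<^sub>n)\<^sub>p\<close> of sequences tending to the two boundary points,
  so that no geodesic in \<open>X\<close> with end points at infinity has to be constructed.

  Coarse richness comes from \<open>Y\<close>. Given \<open>p\<close> and \<open>q\<close>, geodesic richness supplies a line in \<open>Y\<close> near
  \<open>f p\<close> and away from \<open>f q\<close>. Its two ends are images of boundary points of \<open>X\<close>, and Gromov products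
  can be pulled back along \<open>f\<close> since a quasi-isometric embedding of hyperbolic spaces distorts them
  at most linearly (\<open>qi_embedding_gromov_prod\<close>). This distortion estimate is the only place where
  the stability of quasi-geodesics enters.

  Rigidity: if \<open>g\<close> acts trivially on the boundary, then a geodesic joining two boundary points is
  coarsely preserved by \<open>g\<close>. If such a geodesic passes close to \<open>x\<close>, it passes close to \<open>g x\<close> too,
  and coarse richness for \<open>x\<close> and \<open>g x\<close> bounds their distance.

  Uniform perfectness: up to bounded factors, the visual distance of \<open>\<xi>\<close> and \<open>\<zeta>\<close> is
  \<open>e\<^sup>-\<^sup>\<epsilon>\<^sup>T\<close>, where \<open>T\<close> is the distance from the base point at which the ways to \<open>\<xi>\<close> and \<open>\<zeta>\<close>
  separate. Hence for each \<open>\<xi>\<close> and \<open>T\<close> a boundary point is needed that branches off at about \<open>T\<close>.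
  Coarse richness for two points on the way to \<open>\<xi>\<close>, the first of them at distance \<open>T\<close> and the
  second a fixed distance further on, yields a geodesic through the first point one of whose ends
  has this property (\<open>coarsely_rich_branching\<close>).
\<close>

section \<open>Geodesic segments\<close>

lemma geodesic_segmentE:
  assumes "geodesic_segment A x y"
  obtains g where "g 0 = x" "g (dist x y) = y"
    "\<And>s t. s \<in> {0..dist x y} \<Longrightarrow> t \<in> {0..dist x y} \<Longrightarrow> dist (g s) (g t) = \<bar>s - t\<bar>"
    "A = g ` {0..dist x y}"
  using assms unfolding geodesic_segment_def by blast

lemma geodesic_segment_subpath:
  fixes g :: "real \<Rightarrow> 'a::metric_space"
  assumes iso: "\<And>u v. u \<in> {a..b} \<Longrightarrow> v \<in> {a..b} \<Longrightarrow> dist (g u) (g v) = \<bar>u - v\<bar>"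
    and st: "a \<le> s" "s \<le> t" "t \<le> b"
  shows "geodesic_segment (g ` {s..t}) (g s) (g t)"
proof -
  have d: "dist (g s) (g t) = t - s"
    using iso[of s t] st by auto
  have im: "g ` {s..t} = (\<lambda>u. g (s + u)) ` {0..t - s}"
  proof -
    have "{s..t} = (\<lambda>u. s + u) ` {0..t - s}"
      using st by (simp add: image_add_atLeastAtMost)
    then show ?thesis by (metis image_image)
  qed
  show ?thesis
    unfolding geodesic_segment_def d
    by (rule exI[of _ "\<lambda>u. g (s + u)"]) (use st iso im in auto)
qed

lemma geodesic_segment_sym:
  assumes "geodesic_segment A x y"
  shows "geodesic_segment A y x"
proof -
  obtain g where g: "g 0 = x" "g (dist x y) = y"
    "\<And>s t. s \<in> {0..dist x y} \<Longrightarrow> t \<in> {0..dist x y} \<Longrightarrow> dist (g s) (g t) = \<bar>s - t\<bar>"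
    "A = g ` {0..dist x y}"
    using geodesic_segmentE[OF assms] by metis
  have im: "A = (\<lambda>u. g (dist x y - u)) ` {0..dist x y}"
  proof -
    have "{0..dist x y} = (\<lambda>u. dist x y - u) ` {0..dist x y}"
      by (simp add: image_diff_atLeastAtMost)
    then show ?thesis using g(4) by (metis image_image)
  qed
  show ?thesis
    unfolding geodesic_segment_def dist_commute[of y x]
    by (rule exI[of _ "\<lambda>u. g (dist x y - u)"]) (use g im in auto)
qed

lemma geodesic_segment_ends:
  assumes "geodesic_segment A x y"
  shows "x \<in> A" "y \<in> A"
  using geodesic_segmentE[OF assms] by (metis atLeastAtMost_iff image_eqI order_refl zero_le_dist)+

lemma geodesic_segment_dist:
  assumes "geodesic_segment A x y" "u \<in> A"
  shows "dist x u + dist u y = dist x y"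
proof -
  obtain g where g: "g 0 = x" "g (dist x y) = y"
    "\<And>s t. s \<in> {0..dist x y} \<Longrightarrow> t \<in> {0..dist x y} \<Longrightarrow> dist (g s) (g t) = \<bar>s - t\<bar>"
    "A = g ` {0..dist x y}"
    using geodesic_segmentE[OF assms(1)] by metis
  obtain s where s: "s \<in> {0..dist x y}" "u = g s"
    using assms(2) g(4) by blast
  have "dist (g 0) (g s) = s" "dist (g s) (g (dist x y)) = dist x y - s"
    using g(3)[of 0 s] g(3)[of s "dist x y"] s(1) by auto
  then show ?thesis using g s by simp
qed

lemma isometric_path_continuous:
  fixes g :: "real \<Rightarrow> 'a::metric_space"
  assumes "\<And>s t. s \<in> I \<Longrightarrow> t \<in> I \<Longrightarrow> dist (g s) (g t) = \<bar>s - t\<bar>"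
  shows "continuous_on I g"
  unfolding continuous_on_iff using assms by (metis dist_real_def)

lemma geodesic_segment_compact_connected:
  assumes "geodesic_segment A x y"
  shows "compact A" "connected A"
proof -
  obtain g where g:
    "\<And>s t. s \<in> {0..dist x y} \<Longrightarrow> t \<in> {0..dist x y} \<Longrightarrow> dist (g s) (g t) = \<bar>s - t\<bar>"
    "A = g ` {0..dist x y}"
    using geodesic_segmentE[OF assms] by metis
  have "continuous_on {0..dist x y} g"
    using isometric_path_continuous g(1) by metis
  then show "compact A" "connected A"
    using g(2) compact_continuous_image[of _ g] connected_continuous_image[of _ g] by auto
qed

lemma infdist_le_obtain:
  assumes "infdist p S \<le> d" "S \<noteq> {}" "d < e"
  obtains q where "q \<in> S" "dist p q < e"
proof -
  have "(INF a\<in>S. dist p a) < e"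
    using assms by (simp add: infdist_notempty)
  then obtain q where "q \<in> S" "dist p q < e"
    using assms(2) by (meson bdd_below_image_dist cINF_less_iff)
  then show thesis by (rule that)
qed

text \<open>A connected set cannot be split into two disjoint relatively closed pieces. This is how a
  point close to two sets at once is found, first for two sides of a triangle and later for two
  halves of a quasi-geodesic.\<close>

lemma connected_near_both:
  assumes "connected A" "A \<subseteq> closed_nbhd d (S \<union> T)" "S \<noteq> {}" "T \<noteq> {}"
    and "x \<in> A" "x \<in> S" "y \<in> A" "y \<in> T" "d < e" "0 \<le> d"
  obtains u s t where "u \<in> A" "s \<in> S" "t \<in> T" "dist u s < e" "dist u t < e"
proof -
  have cl: "closed (closed_nbhd d U)" for U :: "'a set"
    unfolding closed_nbhd_def
    by (rule closed_Collect_le) (auto intro: continuous_intros)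
  have cov: "A \<subseteq> closed_nbhd d S \<union> closed_nbhd d T"
    using assms(2-4) by (auto simp: closed_nbhd_def infdist_Un_min min_le_iff_disj)
  have "x \<in> closed_nbhd d S" "y \<in> closed_nbhd d T"
    using assms by (auto simp: closed_nbhd_def)
  then have "closed_nbhd d S \<inter> closed_nbhd d T \<inter> A \<noteq> {}"
    using connected_closedD[OF assms(1) _ cov cl cl] assms(5,7) by blast
  then obtain u where u: "u \<in> A" "infdist u S \<le> d" "infdist u T \<le> d"
    by (auto simp: closed_nbhd_def)
  show thesis
    using infdist_le_obtain[OF u(2) assms(3,9)] infdist_le_obtain[OF u(3) assms(4,9)] u(1) that
    by metis
qed

section \<open>Hyperbolicity and the four point inequality\<close>

text \<open>In contrast to \<^const>\<open>delta_hyperbolic\<close>, a point on the other sides is provided instead of a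
  bound on an infimum. Passing to a larger constant makes up for the difference.\<close>

definition slim_triangles :: "'a::metric_space itself \<Rightarrow> real \<Rightarrow> bool" where
  "slim_triangles _ d \<longleftrightarrow>
     (\<forall>(x::'a) y z A B C. geodesic_segment A x y \<longrightarrow> geodesic_segment B y z \<longrightarrow>
        geodesic_segment C z x \<longrightarrow> (\<forall>p\<in>A. \<exists>q\<in>B \<union> C. dist p q \<le> d))"

definition four_point :: "'a::metric_space itself \<Rightarrow> real \<Rightarrow> bool" where
  "four_point _ h \<longleftrightarrow>
     (\<forall>(w::'a) x y z. min (gromov_prod w x y) (gromov_prod w y z) - h \<le> gromov_prod w x z)"

lemma gromov_prod_commute: "gromov_prod w x y = gromov_prod w y x"
  by (simp add: gromov_prod_def dist_commute)

lemma gromov_prod_nonneg: "0 \<le> gromov_prod w x y"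
  unfolding gromov_prod_def using dist_triangle[of x y w] by (simp add: dist_commute)

lemma gromov_prod_le_dist: "gromov_prod w x y \<le> dist w x"
  unfolding gromov_prod_def using dist_triangle[of y w x] by (simp add: dist_commute)

lemma gromov_prod_change_base: "gromov_prod w x y \<le> gromov_prod w' x y + dist w w'"
  unfolding gromov_prod_def using dist_triangle[of x w w'] dist_triangle[of y w w']
  by (simp add: dist_commute field_simps)

lemma gromov_prod_le_dist_segment:
  assumes "geodesic_segment A x y" "u \<in> A"
  shows "gromov_prod w x y \<le> dist w u"
  using geodesic_segment_dist[OF assms] dist_triangle[of x w u] dist_triangle[of y w u]
  unfolding gromov_prod_def by (simp add: dist_commute field_simps)

lemma hyperbolic_slim_triangles:
  assumes "delta_hyperbolic TYPE('a::metric_space) \<delta>" "\<delta> < d"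
  shows "slim_triangles TYPE('a) d"
  unfolding slim_triangles_def
proof (intro allI impI ballI)
  fix x y z :: 'a and A B C p
  assume *: "geodesic_segment A x y" "geodesic_segment B y z" "geodesic_segment C z x" "p \<in> A"
  then have "A \<subseteq> closed_nbhd \<delta> (B \<union> C)"
    using assms(1) unfolding delta_hyperbolic_def by blast
  then have "infdist p (B \<union> C) \<le> \<delta>" "B \<union> C \<noteq> {}"
    using * geodesic_segment_ends by (auto simp: closed_nbhd_def)
  then show "\<exists>q\<in>B \<union> C. dist p q \<le> d"
    using infdist_le_obtain[OF _ _ assms(2)] by (metis less_imp_le)
qed

text \<open>The Gromov product is the distance to a geodesic, up to an error: some point of \<open>A\<close> is close
  to both of the other sides of the triangle with vertices \<open>w\<close>, \<open>x\<close>, \<open>y\<close>, and the broken paths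
  through it are almost geodesic.\<close>

lemma slim_segment_near:
  fixes w :: "'a::metric_space"
  assumes geo: "geodesic_space TYPE('a)" and sl: "slim_triangles TYPE('a) d" and d: "0 \<le> d"
    and A: "geodesic_segment A x y"
  obtains u where "u \<in> A" "dist w u \<le> gromov_prod w x y + 2 * (d + 1)"
proof -
  obtain B C where B: "geodesic_segment B y w" and C: "geodesic_segment C w x"
    using geo unfolding geodesic_space_def by metis
  have cov: "A \<subseteq> closed_nbhd d (B \<union> C)"
  proof
    fix p assume "p \<in> A"
    then obtain q where q: "q \<in> B \<union> C" "dist p q \<le> d"
      using sl A B C unfolding slim_triangles_def by blast
    show "p \<in> closed_nbhd d (B \<union> C)"
      using infdist_le2[OF q] by (simp add: closed_nbhd_def)
  qed
  have ends: "y \<in> B" "x \<in> C" "y \<in> A" "x \<in> A"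
    using geodesic_segment_ends[OF A] geodesic_segment_ends[OF B] geodesic_segment_ends[OF C]
    by auto
  obtain u s t where u: "u \<in> A" "s \<in> B" "t \<in> C" "dist u s < d + 1" "dist u t < d + 1"
    using connected_near_both[OF geodesic_segment_compact_connected(2)[OF A] cov, of y x "d+1"]
      ends d by (metis empty_iff less_add_one)
  have "dist y s + dist s w = dist y w" "dist w t + dist t x = dist w x"
    "dist x u + dist u y = dist x y"
    using geodesic_segment_dist[OF B u(2)] geodesic_segment_dist[OF C u(3)]
      geodesic_segment_dist[OF A u(1)] by auto
  moreover have "dist y u \<le> dist y s + dist u s" "dist w u \<le> dist s w + dist u s"
    "dist w u \<le> dist w t + dist u t" "dist x u \<le> dist t x + dist u t"
    using dist_triangle[of y u s] dist_triangle[of w u s] dist_triangle[of w u t]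
      dist_triangle[of x u t] by (simp_all add: dist_commute)
  ultimately have "dist w u \<le> gromov_prod w x y + 2 * (d + 1)"
    unfolding gromov_prod_def using u(4,5) by (simp add: dist_commute field_simps)
  then show thesis using that u(1) by blast
qed

text \<open>A point of the segment from \<open>x\<close> to \<open>z\<close> almost closest to \<open>w\<close> is near one of the other two
  sides of the triangle with vertices \<open>x\<close>, \<open>y\<close>, \<open>z\<close>, and distances from \<open>w\<close> to these sides are bounded below by
  Gromov products.\<close>

lemma slim_imp_four_point:
  assumes geo: "geodesic_space TYPE('a::metric_space)" and sl: "slim_triangles TYPE('a) d"
    and d: "0 \<le> d"
  shows "four_point TYPE('a) (3 * (d + 1))"
  unfolding four_point_def
proof (intro allI)
  fix w x y z :: 'a
  obtain A B C where A: "geodesic_segment A x z" and B: "geodesic_segment B z y"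
    and C: "geodesic_segment C y x"
    using geo unfolding geodesic_space_def by metis
  obtain u where u: "u \<in> A" "dist w u \<le> gromov_prod w x z + 2 * (d + 1)"
    using slim_segment_near[OF geo sl d A] by metis
  obtain v where v: "v \<in> B \<union> C" "dist u v \<le> d"
    using sl A B C u(1) unfolding slim_triangles_def by blast
  have "min (gromov_prod w x y) (gromov_prod w y z) \<le> dist w v"
    using v(1) gromov_prod_le_dist_segment[OF B, of v w] gromov_prod_le_dist_segment[OF C, of v w]
    by (auto simp: gromov_prod_commute)
  also have "\<dots> \<le> dist w u + dist u v" by (rule dist_triangle)
  finally show "min (gromov_prod w x y) (gromov_prod w y z) - 3 * (d + 1) \<le> gromov_prod w x z"
    using u(2) v(2) by simp
qed

lemma gromov_hyperbolicE:
  assumes "gromov_hyperbolic TYPE('a::metric_space)"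
  obtains d where "0 \<le> d" "geodesic_space TYPE('a)" "slim_triangles TYPE('a) d"
    "four_point TYPE('a) (3 * (d + 1))"
proof -
  obtain \<delta> where \<delta>: "\<delta> \<ge> 0" "delta_hyperbolic TYPE('a) \<delta>"
    using assms unfolding gromov_hyperbolic_def by blast
  have g: "geodesic_space TYPE('a)"
    using \<delta>(2) unfolding delta_hyperbolic_def by blast
  have s: "slim_triangles TYPE('a) (\<delta> + 1)"
    using hyperbolic_slim_triangles[OF \<delta>(2)] by simp
  show thesis
    using that[of "\<delta> + 1"] \<delta>(1) g s slim_imp_four_point[OF g s] by simp
qed

lemma four_pointD:
  assumes "four_point TYPE('a::metric_space) h"
  shows "min (gromov_prod (w::'a) x y) (gromov_prod w y z) - h \<le> gromov_prod w x z"
  using assms unfolding four_point_def by blast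

text \<open>In the application, \<open>x\<close>, \<open>x'\<close> and \<open>y\<close>, \<open>y'\<close> run towards the same boundary points, so that
  two of the three terms of the minimum are large.\<close>

lemma four_point_twice:
  fixes w :: "'a::metric_space"
  assumes "four_point TYPE('a) h" "0 \<le> h"
  shows "min (gromov_prod w x x') (min (gromov_prod w x' y') (gromov_prod w y' y)) - 2 * h
    \<le> gromov_prod w x y"
  using four_pointD[OF assms(1), of w x x' y] four_pointD[OF assms(1), of w x' y' y] assms(2)
  by linarith

section \<open>Stability of quasi-geodesics\<close>

definition quasi_geodesic :: "real \<Rightarrow> real \<Rightarrow> real \<Rightarrow> (real \<Rightarrow> 'b::metric_space) \<Rightarrow> bool" where
  "quasi_geodesic K C l F \<longleftrightarrow> (\<forall>u\<in>{0..l}. \<forall>v\<in>{0..l}.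
     \<bar>u - v\<bar> / K - C \<le> dist (F u) (F v) \<and> dist (F u) (F v) \<le> K * \<bar>u - v\<bar> + C)"

text \<open>Bisecting the path \<open>k\<close> times and using a slim triangle at each bisection shows that a
  geodesic is at most logarithmically (in the number of steps) far away from any path with the same
  end points. Since lengths grow exponentially in the distance from a geodesic, a path that runs
  linearly fast cannot afford to leave it.\<close>

lemma discrete_path_near_geodesic:
  fixes c :: "nat \<Rightarrow> 'b::metric_space"
  assumes geo: "geodesic_space TYPE('b)" and sl: "slim_triangles TYPE('b) d"
    and step: "\<And>i. dist (c i) (c (Suc i)) \<le> M"
    and "geodesic_segment S (c i) (c (i + 2 ^ k))" "p \<in> S"
  shows "\<exists>j. dist p (c j) \<le> real k * d + M"
  using assms(4,5)
proof (induction k arbitrary: i S p)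
  case 0
  then have "dist (c i) p + dist p (c (Suc i)) = dist (c i) (c (Suc i))"
    using geodesic_segment_dist by fastforce
  then have "dist p (c i) \<le> M"
    using step[of i] zero_le_dist[of p "c (Suc i)"] dist_commute[of p "c i"] by linarith
  then show ?case by auto
next
  case (Suc k)
  let ?m = "i + 2 ^ k"
  obtain B where B: "geodesic_segment B (c (i + 2 ^ Suc k)) (c ?m)"
    using geo unfolding geodesic_space_def by metis
  obtain C where C: "geodesic_segment C (c ?m) (c i)"
    using geo unfolding geodesic_space_def by metis
  have B': "geodesic_segment B (c ?m) (c (?m + 2 ^ k))"
    using geodesic_segment_sym[OF B] by (simp add: mult_2 add.assoc)
  obtain q where q: "q \<in> B \<union> C" "dist p q \<le> d"
    using sl Suc.prems B C unfolding slim_triangles_def by blast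
  obtain j where "dist q (c j) \<le> real k * d + M"
    using Suc.IH[OF B'] Suc.IH[OF geodesic_segment_sym[OF C]] q(1) by blast
  then have "dist p (c j) \<le> real (Suc k) * d + M"
    using q(2) dist_triangle[of p "c j" q] by (simp add: algebra_simps)
  then show ?case by blast
qed

lemma coarse_path_near_geodesic:
  fixes F :: "real \<Rightarrow> 'b::metric_space"
  assumes geo: "geodesic_space TYPE('b)" and sl: "slim_triangles TYPE('b) d"
    and F: "quasi_geodesic K C l F" and K: "1 \<le> K"
    and st: "s \<in> {0..l}" "t \<in> {0..l}" "\<bar>s - t\<bar> \<le> 2 ^ k"
    and S: "geodesic_segment S (F s) (F t)" "v \<in> S"
  shows "\<exists>r\<in>{0..l}. dist v (F r) \<le> real k * d + (K + C)"
  using st S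
proof (induction s t rule: linorder_wlog)
  case (sym a b)
  then show ?case
    by (metis abs_minus_commute geodesic_segment_sym)
next
  case (le s t)
  define c where "c i = F (min (s + real i) t)" for i :: nat
  have mem: "min (s + real i) t \<in> {0..l}" for i :: nat
    using le by auto
  have step: "dist (c i) (c (Suc i)) \<le> K + C" for i
  proof -
    have "dist (c i) (c (Suc i)) \<le> K * \<bar>min (s + real i) t - min (s + real (Suc i)) t\<bar> + C"
      using F mem unfolding quasi_geodesic_def c_def by blast
    also have "\<dots> \<le> K * 1 + C"
      using K by (intro add_right_mono mult_left_mono) auto
    finally show ?thesis by simp
  qed
  have "c 0 = F s" "c (0 + 2 ^ k) = F t"
    using le by (auto simp: c_def min_absorb1 min_absorb2)
  then obtain j where "dist v (c j) \<le> real k * d + (K + C)"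
    using discrete_path_near_geodesic[where c = c and M = "K + C" and i = 0 and k = k, OF geo sl step] le
    by auto
  then show ?case
    using mem[of j] unfolding c_def by blast
qed

lemma bounded_by_own_logarithm:
  fixes a b \<alpha> \<beta> :: real
  assumes "0 < \<alpha>" "0 < b"
  obtains E0 where
    "\<And>E. 0 < \<alpha> * E + \<beta> \<Longrightarrow> E \<le> a + b * log 2 (\<alpha> * E + \<beta>) \<Longrightarrow> E \<le> E0"
proof -
  \<comment> \<open>The tangent to the logarithm whose slope makes the right hand side grow like \<open>E / 2\<close>.\<close>
  define c where "c = ln 2 / (2 * b * \<alpha>)"
  have c: "0 < c" using assms by (simp add: c_def)
  have "E \<le> 2 * (a + b / ln 2 * (c * \<beta> - 1 - ln c))"
    if y: "0 < \<alpha> * E + \<beta>" and E: "E \<le> a + b * log 2 (\<alpha> * E + \<beta>)" for E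
  proof -
    have "ln (c * (\<alpha> * E + \<beta>)) \<le> c * (\<alpha> * E + \<beta>) - 1"
      using c y by (intro ln_le_minus_one) simp
    then have "ln (\<alpha> * E + \<beta>) \<le> c * (\<alpha> * E + \<beta>) - 1 - ln c"
      using c y by (simp add: ln_mult)
    then have "b / ln 2 * ln (\<alpha> * E + \<beta>) \<le> b / ln 2 * (c * (\<alpha> * E + \<beta>) - 1 - ln c)"
      using assms by (intro mult_left_mono) auto
    also have "\<dots> = E / 2 + b / ln 2 * (c * \<beta> - 1 - ln c)"
      using assms by (simp add: c_def field_simps)
    finally show ?thesis using E by (simp add: log_def)
  qed
  then show thesis by (rule that)
qed

text \<open>Let \<open>m\<close> be a point of the geodesic at maximal distance from the quasi-geodesic. Points at
  distance \<open>2 E\<close> on either side of \<open>m\<close>, with \<open>E\<close> just above the maximal distance, are joined by a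
  detour along the quasi-geodesic that stays away from \<open>m\<close> but has length linear in \<open>E\<close>. By the
  preceding lemma \<open>E\<close> is bounded by its own logarithm.\<close>

lemma geodesic_near_quasi_geodesic:
  assumes geo: "geodesic_space TYPE('b::metric_space)" and sl: "slim_triangles TYPE('b) d"
    and d: "0 \<le> d" and K: "1 \<le> K" and C: "0 \<le> C"
  obtains H where "0 \<le> H" "\<And>l (F :: real \<Rightarrow> 'b) B p. 0 \<le> l \<Longrightarrow> quasi_geodesic K C l F \<Longrightarrow>
    geodesic_segment B (F 0) (F l) \<Longrightarrow> p \<in> B \<Longrightarrow> infdist p (F ` {0..l}) \<le> H"
proof -
  obtain E0 where E0: "\<And>E. 0 < (6 * K) * E + (K * C + 1) \<Longrightarrow>
      E \<le> (1 + 3 * d + K + C) + (d + 1) * log 2 ((6 * K) * E + (K * C + 1)) \<Longrightarrow> E \<le> E0"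
    using bounded_by_own_logarithm[of "6 * K" "d + 1" "K * C + 1" "1 + 3 * d + K + C"] K d by auto
  have main: "infdist p (F ` {0..l}) \<le> max (2 * d) E0"
    if l: "0 \<le> l" and F: "quasi_geodesic K C l F"
      and B: "geodesic_segment B (F 0) (F l)" and p: "p \<in> B" for l :: real and F :: "real \<Rightarrow> 'b" and B p
  proof -
    let ?I = "F ` {0..l}"
    have ne: "?I \<noteq> {}" using l by auto
    have "continuous_on B (\<lambda>x. infdist x ?I)"
      by (intro continuous_intros)
    then obtain m where m: "m \<in> B" "\<And>x. x \<in> B \<Longrightarrow> infdist x ?I \<le> infdist m ?I"
      using continuous_attains_sup[OF geodesic_segment_compact_connected(1)[OF B]] p by blast
    define E where "E = infdist m ?I + 1"
    have E1: "1 \<le> E" unfolding E_def by (simp add: infdist_nonneg)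
    have near: "\<exists>s\<in>{0..l}. dist x (F s) \<le> E" if "x \<in> B" for x
      using infdist_le_obtain[OF m(2)[OF that] ne, of E] unfolding E_def
      by (metis imageE less_add_one less_imp_le)
    have far: "E - 1 \<le> dist m (F r)" if "r \<in> {0..l}" for r
      using infdist_le[of "F r" ?I m] that unfolding E_def by auto
    define L where "L = dist (F 0) (F l)"
    obtain g where g: "g 0 = F 0" "g L = F l"
      "\<And>s t. s \<in> {0..L} \<Longrightarrow> t \<in> {0..L} \<Longrightarrow> dist (g s) (g t) = \<bar>s - t\<bar>"
      "B = g ` {0..L}"
      using geodesic_segmentE[OF B] unfolding L_def by metis
    obtain \<tau> where \<tau>: "\<tau> \<in> {0..L}" "m = g \<tau>" using m(1) g(4) by auto
    define a b where "a = max 0 (\<tau> - 2 * E)" and "b = min L (\<tau> + 2 * E)"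
    have ab: "a \<in> {0..L}" "b \<in> {0..L}" "a \<le> \<tau>" "\<tau> \<le> b" "\<tau> - a \<le> 2 * E" "b - \<tau> \<le> 2 * E"
      using \<tau>(1) E1 unfolding a_def b_def by auto
    have S0: "geodesic_segment (g ` {a..b}) (g a) (g b)" "m \<in> g ` {a..b}"
      using geodesic_segment_subpath[OF g(3), of a b] ab \<tau> by auto
    have "\<exists>s\<in>{0..l}. dist (g a) (F s) \<le> E \<and> (g a = F s \<or> dist m (g a) = 2 * E)"
    proof (cases "a = 0")
      case True
      then show ?thesis using l g(1) E1 by (intro bexI[of _ 0]) auto
    next
      case False
      then have "dist m (g a) = 2 * E"
        using g(3)[of \<tau> a] \<tau> ab(1) E1 unfolding a_def by (auto simp: max_def split: if_splits)
      then show ?thesis using near[of "g a"] ab(1) g(4) by blast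
    qed
    then obtain s where s: "s \<in> {0..l}" "dist (g a) (F s) \<le> E" "g a = F s \<or> dist m (g a) = 2 * E"
      by blast
    have "\<exists>t\<in>{0..l}. dist (g b) (F t) \<le> E \<and> (g b = F t \<or> dist m (g b) = 2 * E)"
    proof (cases "b = L")
      case True
      then show ?thesis using l g(2) E1 by (intro bexI[of _ l]) auto
    next
      case False
      then have "dist m (g b) = 2 * E"
        using g(3)[of \<tau> b] \<tau> ab(2) E1 unfolding b_def by (auto simp: min_def split: if_splits)
      then show ?thesis using near[of "g b"] ab(2) g(4) by blast
    qed
    then obtain t where t: "t \<in> {0..l}" "dist (g b) (F t) \<le> E" "g b = F t \<or> dist m (g b) = 2 * E"
      by blast
    obtain T1 T2 where T1: "geodesic_segment T1 (g b) (F t)" and T2: "geodesic_segment T2 (F t) (g a)"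
      using geo unfolding geodesic_space_def by metis
    obtain T3 T4 where T3: "geodesic_segment T3 (g a) (F s)" and T4: "geodesic_segment T4 (F s) (F t)"
      using geo unfolding geodesic_space_def by metis
    obtain q where q: "q \<in> T1 \<union> T2" "dist m q \<le> d"
      using sl S0 T1 T2 unfolding slim_triangles_def by blast
    have "\<exists>v\<in>T1 \<union> T3 \<union> T4. dist m v \<le> 2 * d"
    proof (cases "q \<in> T1")
      case True
      then show ?thesis using q(2) d by (intro bexI[of _ q]) auto
    next
      case False
      then obtain v where "v \<in> T3 \<union> T4" "dist q v \<le> d"
        using sl T2 T3 T4 q(1) unfolding slim_triangles_def by blast
      then show ?thesis using q(2) dist_triangle[of m v q] by (intro bexI[of _ v]) auto
    qed
    then obtain v where v: "v \<in> T1 \<union> T3 \<union> T4" "dist m v \<le> 2 * d" by blast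
    \<comment> \<open>The short connections at the two ends are either trivial or too far away from \<open>m\<close>.\<close>
    have side: "E \<le> 2 * d + 1"
      if "geodesic_segment T y (F r)" "v \<in> T" "dist y (F r) \<le> E" "r \<in> {0..l}"
        "y = F r \<or> dist m y = 2 * E" for T y r
    proof -
      have yv: "dist y v \<le> dist y (F r)"
        using geodesic_segment_dist[OF that(1,2)] zero_le_dist[of v "F r"] by linarith
      show ?thesis
        using that(5)
      proof
        assume "y = F r"
        then have "v = F r" using yv by simp
        then show ?thesis using far[OF that(4)] v(2) by simp
      next
        assume "dist m y = 2 * E"
        then show ?thesis using yv that(3) v(2) dist_triangle[of m y v] by (simp add: dist_commute)
      qed
    qed
    consider "v \<in> T1 \<union> T3" | "v \<in> T4" using v(1) by blast
    then have "infdist m ?I \<le> max (2 * d) E0"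
    proof cases
      case 1
      then have "E \<le> 2 * d + 1"
        using side[OF T1 _ t(2,1,3)] side[OF T3 _ s(2,1,3)] by blast
      then show ?thesis unfolding E_def by simp
    next
      case 2
      define Z where "Z = (6 * K) * E + (K * C + 1)"
      define k where "k = nat \<lceil>log 2 Z\<rceil>"
      have Z: "1 \<le> Z" using K C E1 unfolding Z_def by simp
      have "dist (F s) (F t) \<le> dist (F s) (g a) + dist (g a) (g b) + dist (g b) (F t)"
        using dist_triangle[of "F s" "F t" "g a"] dist_triangle[of "g a" "F t" "g b"] by linarith
      moreover have "dist (g a) (g b) \<le> 4 * E"
        using g(3)[OF ab(1,2)] ab by linarith
      ultimately have "dist (F s) (F t) \<le> 6 * E"
        using s(2) t(2) by (simp add: dist_commute)
      moreover have "\<bar>s - t\<bar> / K - C \<le> dist (F s) (F t)"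
        using F s(1) t(1) unfolding quasi_geodesic_def by blast
      ultimately have "\<bar>s - t\<bar> / K \<le> 6 * E + C" by linarith
      then have "\<bar>s - t\<bar> \<le> Z"
        using K unfolding Z_def by (simp add: field_simps)
      also have "Z \<le> 2 ^ k"
      proof -
        have "log 2 Z \<le> real k" unfolding k_def using Z by linarith
        then have "Z \<le> 2 powr real k" using Z by (simp add: log_le_iff)
        then show ?thesis by (simp add: powr_realpow)
      qed
      finally obtain r where r: "r \<in> {0..l}" "dist v (F r) \<le> real k * d + (K + C)"
        using coarse_path_near_geodesic[OF geo sl F K s(1) t(1) _ T4 2] by blast
      have "real k \<le> log 2 Z + 1" unfolding k_def using Z by (simp add: le_of_int_ceiling)
      then have "real k * d \<le> (log 2 Z + 1) * d" using d by (rule mult_right_mono)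
      then have "E \<le> (1 + 3 * d + K + C) + d * log 2 Z"
        using far[OF r(1)] r(2) v(2) dist_triangle[of m "F r" v] by (simp add: algebra_simps)
      also have "\<dots> \<le> (1 + 3 * d + K + C) + (d + 1) * log 2 Z"
        using Z by (simp add: algebra_simps)
      finally have "E \<le> E0" using Z unfolding Z_def by (intro E0) auto
      then show ?thesis unfolding E_def by simp
    qed
    then show ?thesis using m(2)[OF p] by linarith
  qed
  show thesis by (rule that[OF _ main]) (use d in auto)
qed

text \<open>By connectedness some point of the geodesic is close to the quasi-geodesic both before and
  after a given time, so little time passes in between.\<close>

lemma quasi_geodesic_near_geodesic:
  assumes geo: "geodesic_space TYPE('b::metric_space)" and sl: "slim_triangles TYPE('b) d"
    and d: "0 \<le> d" and K: "1 \<le> K" and C: "0 \<le> C"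
  obtains H where "0 \<le> H" "\<And>l (F :: real \<Rightarrow> 'b) B s. quasi_geodesic K C l F \<Longrightarrow>
    geodesic_segment B (F 0) (F l) \<Longrightarrow> s \<in> {0..l} \<Longrightarrow> \<exists>b\<in>B. dist (F s) b \<le> H"
proof -
  obtain D where D: "0 \<le> D" "\<And>l (F :: real \<Rightarrow> 'b) B p. 0 \<le> l \<Longrightarrow> quasi_geodesic K C l F \<Longrightarrow>
    geodesic_segment B (F 0) (F l) \<Longrightarrow> p \<in> B \<Longrightarrow> infdist p (F ` {0..l}) \<le> D"
    using geodesic_near_quasi_geodesic[OF geo sl d K C] by metis
  define H where "H = K * (K * (2 * D + 2 + C)) + C + D + 1"
  have "\<exists>b\<in>B. dist (F s) b \<le> H"
    if F: "quasi_geodesic K C l F" and B: "geodesic_segment B (F 0) (F l)" and s: "s \<in> {0..l}"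
    for l and F :: "real \<Rightarrow> 'b" and B s
  proof -
    have un: "F ` {0..l} = F ` {0..s} \<union> F ` {s..l}"
      using s by (simp add: image_Un[symmetric] ivl_disj_un_two_touch)
    have cov: "B \<subseteq> closed_nbhd D (F ` {0..s} \<union> F ` {s..l})"
      using D(2)[OF _ F B] s unfolding un[symmetric] closed_nbhd_def by auto
    obtain b x y where b: "b \<in> B" "x \<in> F ` {0..s}" "y \<in> F ` {s..l}" "dist b x < D + 1" "dist b y < D + 1"
      by (rule connected_near_both[OF geodesic_segment_compact_connected(2)[OF B] cov,
            of "F 0" "F l" "D + 1"])
        (use s D(1) geodesic_segment_ends[OF B] in auto)
    then obtain u v where uv: "u \<in> {0..s}" "v \<in> {s..l}" "x = F u" "y = F v" by blast
    have "dist (F u) (F v) \<le> 2 * D + 2"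
      using b(4,5) uv dist_triangle3[of "F u" "F v" b] by simp
    moreover have "\<bar>u - v\<bar> / K - C \<le> dist (F u) (F v)"
      using F uv(1,2) s unfolding quasi_geodesic_def by (meson atLeastAtMost_iff order_trans)
    ultimately have "\<bar>u - v\<bar> / K \<le> 2 * D + 2 + C" by linarith
    then have "\<bar>u - v\<bar> \<le> K * (2 * D + 2 + C)"
      using K by (simp add: field_simps)
    then have "K * \<bar>s - u\<bar> \<le> K * (K * (2 * D + 2 + C))"
      using uv K by (intro mult_left_mono) auto
    moreover have "dist (F s) (F u) \<le> K * \<bar>s - u\<bar> + C"
      using F uv(1) s unfolding quasi_geodesic_def by (meson atLeastAtMost_iff order_trans)
    ultimately have "dist (F s) b \<le> H"
      using b(4) uv(3) dist_triangle[of "F s" b "F u"] unfolding H_def by (simp add: dist_commute)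
    then show ?thesis using b(1) by blast
  qed
  moreover have "0 \<le> H" unfolding H_def using K C D(1) by simp
  ultimately show thesis using that by blast
qed

text \<open>Gromov products are, up to bounded errors, distances to geodesics, and by stability a
  quasi-isometric embedding maps geodesics close to geodesics.\<close>

proposition qi_embedding_gromov_prod:
  fixes f :: "'a::metric_space \<Rightarrow> 'b::metric_space"
  assumes hX: "gromov_hyperbolic TYPE('a)" and hY: "gromov_hyperbolic TYPE('b)"
    and f: "qi_embedding_with K C f"
  obtains H where "0 \<le> H"
    "\<And>p a b. gromov_prod (f p) (f a) (f b) \<le> K * gromov_prod p a b + H"
    "\<And>p a b. gromov_prod p a b \<le> K * gromov_prod (f p) (f a) (f b) + H"
proof -
  have KC: "1 \<le> K" "0 \<le> C" and fl: "\<And>x y. dist x y / K - C \<le> dist (f x) (f y)"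
    and fu: "\<And>x y. dist (f x) (f y) \<le> K * dist x y + C"
    using f unfolding qi_embedding_with_def by auto
  obtain d where X: "0 \<le> d" "geodesic_space TYPE('a)" "slim_triangles TYPE('a) d"
    using gromov_hyperbolicE[OF hX] by metis
  obtain e where Y: "0 \<le> e" "geodesic_space TYPE('b)" "slim_triangles TYPE('b) e"
    using gromov_hyperbolicE[OF hY] by metis
  obtain D where D: "0 \<le> D" "\<And>l (F :: real \<Rightarrow> 'b) B p. 0 \<le> l \<Longrightarrow> quasi_geodesic K C l F \<Longrightarrow>
    geodesic_segment B (F 0) (F l) \<Longrightarrow> p \<in> B \<Longrightarrow> infdist p (F ` {0..l}) \<le> D"
    using geodesic_near_quasi_geodesic[OF Y(2,3,1) KC] by metis
  obtain G where G: "0 \<le> G" "\<And>l (F :: real \<Rightarrow> 'b) B s. quasi_geodesic K C l F \<Longrightarrow>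
    geodesic_segment B (F 0) (F l) \<Longrightarrow> s \<in> {0..l} \<Longrightarrow> \<exists>b\<in>B. dist (F s) b \<le> G"
    using quasi_geodesic_near_geodesic[OF Y(2,3,1) KC] by metis
  define H where "H = K * (2 * (d + 1)) + C + G + K * (2 * (e + 1) + D + 1 + C)"
  have nn: "0 \<le> K * (2 * (d + 1))" "0 \<le> K * (2 * (e + 1) + D + 1 + C)"
    using KC X(1) Y(1) D(1) by auto
  have "gromov_prod (f p) (f a) (f b) \<le> K * gromov_prod p a b + H \<and>
    gromov_prod p a b \<le> K * gromov_prod (f p) (f a) (f b) + H" for p a b
  proof -
    obtain A where A: "geodesic_segment A a b"
      using X(2) unfolding geodesic_space_def by metis
    obtain g where g: "g 0 = a" "g (dist a b) = b"
      "\<And>s t. s \<in> {0..dist a b} \<Longrightarrow> t \<in> {0..dist a b} \<Longrightarrow> dist (g s) (g t) = \<bar>s - t\<bar>"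
      "A = g ` {0..dist a b}"
      using geodesic_segmentE[OF A] by metis
    have qg: "quasi_geodesic K C (dist a b) (\<lambda>s. f (g s))"
      unfolding quasi_geodesic_def using g(3) fl fu by metis
    obtain B where B: "geodesic_segment B (f a) (f b)"
      using Y(2) unfolding geodesic_space_def by metis
    have B': "geodesic_segment B (f (g 0)) (f (g (dist a b)))"
      using B g by simp
    obtain u where u: "u \<in> A" "dist p u \<le> gromov_prod p a b + 2 * (d + 1)"
      using slim_segment_near[OF X(2,3,1) A] by metis
    obtain b' where b': "b' \<in> B" "dist (f u) b' \<le> G"
      using G(2)[OF qg B'] u(1) unfolding g(4) by blast
    have "gromov_prod (f p) (f a) (f b) \<le> dist (f p) b'"
      by (rule gromov_prod_le_dist_segment[OF B b'(1)])
    also have "\<dots> \<le> dist (f p) (f u) + G"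
      using b'(2) dist_triangle[of "f p" b' "f u"] by simp
    also have "\<dots> \<le> K * dist p u + C + G" using fu[of p u] by simp
    also have "\<dots> \<le> K * (gromov_prod p a b + 2 * (d + 1)) + C + G"
      using u(2) KC by (simp add: mult_left_mono)
    also have "\<dots> \<le> K * gromov_prod p a b + H"
      unfolding H_def using nn by (simp add: algebra_simps)
    finally have 1: "gromov_prod (f p) (f a) (f b) \<le> K * gromov_prod p a b + H" .
    obtain v where v: "v \<in> B" "dist (f p) v \<le> gromov_prod (f p) (f a) (f b) + 2 * (e + 1)"
      using slim_segment_near[OF Y(2,3,1) B] by metis
    have "infdist v ((\<lambda>s. f (g s)) ` {0..dist a b}) \<le> D"
      using D(2)[OF _ qg B' v(1)] by simp
    moreover have "(\<lambda>s. f (g s)) ` {0..dist a b} \<noteq> {}" by simp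
    ultimately obtain y where y: "y \<in> (\<lambda>s. f (g s)) ` {0..dist a b}" "dist v y < D + 1"
      using infdist_le_obtain by (metis less_add_one)
    then obtain s where s: "s \<in> {0..dist a b}" "dist v (f (g s)) < D + 1" by blast
    have "dist p (g s) / K \<le> dist (f p) (f (g s)) + C" using fl[of p "g s"] by linarith
    then have "dist p (g s) \<le> K * (dist (f p) (f (g s)) + C)"
      using KC by (simp add: field_simps)
    also have "\<dots> \<le> K * (gromov_prod (f p) (f a) (f b) + 2 * (e + 1) + D + 1 + C)"
      using KC s(2) v(2) dist_triangle[of "f p" "f (g s)" v] by (intro mult_left_mono) auto
    also have "\<dots> \<le> K * gromov_prod (f p) (f a) (f b) + H"
      unfolding H_def using nn KC(2) G(1) by (simp add: algebra_simps)
    finally have 2: "gromov_prod p a b \<le> K * gromov_prod (f p) (f a) (f b) + H"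
      using gromov_prod_le_dist_segment[OF A, of "g s" p] s(1) g(4) by auto
    from 1 2 show ?thesis by blast
  qed
  moreover have "0 \<le> H" unfolding H_def using nn KC(2) G(1) by linarith
  ultimately show thesis using that by blast
qed

section \<open>Gromov sequences and their classes\<close>

lemma gromov_sequence_eventually:
  "gromov_sequence a \<longleftrightarrow>
     (\<forall>w M. eventually (\<lambda>(i, j). M \<le> gromov_prod w (a i) (a j)) (sequentially \<times>\<^sub>F sequentially))"
  unfolding gromov_sequence_def filterlim_at_top by (simp add: case_prod_unfold)

lemma gromov_sequenceE:
  assumes "gromov_sequence a"
  obtains N where "\<And>i j. N \<le> i \<Longrightarrow> N \<le> j \<Longrightarrow> M \<le> gromov_prod w (a i) (a j)"
proof -
  have "\<exists>N. \<forall>i\<ge>N. \<forall>j\<ge>N. M \<le> gromov_prod w (a j) (a i)"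
    using assms unfolding gromov_sequence_eventually eventually_prod_sequentially
    by (simp add: case_prod_unfold)
  then show thesis using that by auto
qed

lemma gromov_sequenceI:
  fixes a :: "nat \<Rightarrow> 'a::metric_space"
  assumes "\<And>M. \<exists>N. \<forall>i\<ge>N. \<forall>j\<ge>N. M \<le> gromov_prod w (a i) (a j)"
  shows "gromov_sequence a"
proof -
  have "\<exists>N. \<forall>j\<ge>N. \<forall>i\<ge>N. M \<le> gromov_prod w' (a i) (a j)" for w' M
  proof -
    obtain N where N: "\<forall>i\<ge>N. \<forall>j\<ge>N. M + dist w w' \<le> gromov_prod w (a i) (a j)"
      using assms[of "M + dist w w'"] ..
    have "M \<le> gromov_prod w' (a i) (a j)" if "i \<ge> N" "j \<ge> N" for i j
    proof -
      have "M + dist w w' \<le> gromov_prod w (a i) (a j)" using N that by simp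
      then show ?thesis using gromov_prod_change_base[of w "a i" "a j" w'] by linarith
    qed
    then show ?thesis by (intro exI[of _ N]) simp
  qed
  then show ?thesis
    unfolding gromov_sequence_eventually eventually_prod_sequentially by (simp add: case_prod_unfold)
qed

lemma gromov_equivD:
  assumes "(a, b) \<in> gromov_equiv"
  shows "gromov_sequence a" "gromov_sequence b"
    "eventually (\<lambda>n. M \<le> gromov_prod w (a n) (b n)) sequentially"
  using assms unfolding gromov_equiv_def filterlim_at_top by auto

lemma gromov_equiv_sym:
  assumes "(a, b) \<in> gromov_equiv"
  shows "(b, a) \<in> gromov_equiv"
  using assms unfolding gromov_equiv_def by (auto simp: gromov_prod_commute)

lemma gromov_equiv_refl:
  assumes "gromov_sequence a"
  shows "(a, a) \<in> gromov_equiv"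
proof -
  have "eventually (\<lambda>n. M \<le> gromov_prod w (a n) (a n)) sequentially" for w M
    using gromov_sequenceE[OF assms, of M w] unfolding eventually_sequentially by metis
  then show ?thesis
    using assms unfolding gromov_equiv_def filterlim_at_top by auto
qed

lemma gromov_boundary_class:
  fixes a :: "nat \<Rightarrow> 'a::metric_space"
  assumes "gromov_sequence a"
  shows "gromov_equiv `` {a} \<in> gromov_boundary TYPE('a)"
  using assms
  unfolding gromov_boundary_def by (auto intro: quotientI)

lemma gromov_boundaryE:
  fixes \<xi> :: "(nat \<Rightarrow> 'a::metric_space) set"
  assumes "\<xi> \<in> gromov_boundary TYPE('a)"
  obtains a where "gromov_sequence a" "\<xi> = gromov_equiv `` {a}"
  using assms unfolding gromov_boundary_def by (auto elim: quotientE)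

lemma eventually_gromov_prod_le_equiv:
  fixes a b :: "nat \<Rightarrow> 'a::metric_space"
  assumes h: "four_point TYPE('a) h" "0 \<le> h"
    and eq: "(a, a') \<in> gromov_equiv" "(b, b') \<in> gromov_equiv"
    and le: "eventually (\<lambda>n. gromov_prod w (a n) (b n) \<le> R) sequentially"
  shows "eventually (\<lambda>n. gromov_prod w (a' n) (b' n) \<le> R + 2 * h) sequentially"
  using le gromov_equivD(3)[OF eq(1), of "R + 2 * h + 1" w]
    gromov_equivD(3)[OF gromov_equiv_sym[OF eq(2)], of "R + 2 * h + 1" w]
proof eventually_elim
  case (elim n)
  then show ?case
    using four_point_twice[OF h, of w "a n" "a' n" "b' n" "b n"] by linarith
qed

lemma eventually_gromov_prod_ge_equiv:
  fixes a b :: "nat \<Rightarrow> 'a::metric_space"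
  assumes h: "four_point TYPE('a) h" "0 \<le> h"
    and eq: "(a, a') \<in> gromov_equiv" "(b, b') \<in> gromov_equiv"
    and le: "eventually (\<lambda>n. R \<le> gromov_prod w (a n) (b n)) sequentially"
  shows "eventually (\<lambda>n. R - 2 * h \<le> gromov_prod w (a' n) (b' n)) sequentially"
  using le gromov_equivD(3)[OF gromov_equiv_sym[OF eq(1)], of R w]
    gromov_equivD(3)[OF eq(2), of R w]
proof eventually_elim
  case (elim n)
  then show ?case
    using four_point_twice[OF h, of w "a' n" "a n" "b n" "b' n"] by linarith
qed

lemma qi_embedding_gromov_sequence:
  fixes f :: "'a::metric_space \<Rightarrow> 'b::metric_space"
  assumes "gromov_hyperbolic TYPE('a)" "gromov_hyperbolic TYPE('b)"
    and f: "qi_embedding_with K C f" and a: "gromov_sequence a"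
  shows "gromov_sequence (f \<circ> a)"
proof -
  obtain H where H: "\<And>p x y. gromov_prod p x y \<le> K * gromov_prod (f p) (f x) (f y) + H"
    using qi_embedding_gromov_prod[OF assms(1-3)] by metis
  have K: "0 < K" using f unfolding qi_embedding_with_def by simp
  fix p
  show ?thesis
  proof (rule gromov_sequenceI[of "f p"])
    fix M
    obtain N where N: "\<And>i j. N \<le> i \<Longrightarrow> N \<le> j \<Longrightarrow> K * M + H \<le> gromov_prod p (a i) (a j)"
      using gromov_sequenceE[OF a, of "K * M + H" p] by metis
    have "M \<le> gromov_prod (f p) (f (a i)) (f (a j))" if "N \<le> i" "N \<le> j" for i j
    proof -
      have "K * M \<le> K * gromov_prod (f p) (f (a i)) (f (a j))"
        using N[OF that] H[of p "a i" "a j"] by linarith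
      then show ?thesis using K by simp
    qed
    then show "\<exists>N. \<forall>i\<ge>N. \<forall>j\<ge>N. M \<le> gromov_prod (f p) ((f \<circ> a) i) ((f \<circ> a) j)"
      by (intro exI[of _ N]) simp
  qed
qed

section \<open>Coarse richness\<close>

text \<open>This is the first condition of geodesic richness in a form that a quasi-isometric embedding
  can transport: a geodesic line is replaced by two sequences that tend to its ends, the distance
  from it by the Gromov product of the two sequences, and distances only matter up to
  multiplicative and additive constants.\<close>

definition coarsely_rich :: "'a::metric_space itself \<Rightarrow> real \<Rightarrow> real \<Rightarrow> bool" where
  "coarsely_rich _ A R \<longleftrightarrow> 0 < A \<and> (\<forall>(p::'a) q. R \<le> dist p q \<longrightarrow>
     (\<exists>a b. gromov_sequence a \<and> gromov_sequence b \<and>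
        eventually (\<lambda>n. gromov_prod p (a n) (b n) \<le> R) sequentially \<and>
        eventually (\<lambda>n. dist p q / A - R \<le> gromov_prod q (a n) (b n)) sequentially))"

text \<open>The segments of the line between its parameters \<open>- n\<close> and \<open>n\<close> exhaust it. So a point of the line
  that is close to \<open>p\<close> belongs to almost all of them, while none of them comes closer to \<open>p\<close> than
  the whole line does.\<close>

lemma bi_infinite_geodesic_ends:
  fixes \<gamma> :: "'b::metric_space set"
  assumes "geodesic_space TYPE('b)" "slim_triangles TYPE('b) d" "0 \<le> d"
    and "bi_infinite_geodesic \<gamma>"
  obtains u v where "gromov_sequence u" "gromov_sequence v"
    "\<forall>p R. infdist p \<gamma> < R \<longrightarrow> eventually (\<lambda>n. gromov_prod p (u n) (v n) \<le> R) sequentially"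
    "\<forall>p n. infdist p \<gamma> - 2 * (d + 1) \<le> gromov_prod p (u n) (v n)"
proof -
  obtain g :: "real \<Rightarrow> 'b" where g: "\<And>s t. dist (g s) (g t) = \<bar>s - t\<bar>" "\<gamma> = range g"
    using assms(4) unfolding bi_infinite_geodesic_def by blast
  define u v where "u n = g (- real n)" and "v n = g (real n)" for n
  have seg: "geodesic_segment (g ` {- real n..real n}) (u n) (v n)" for n
    unfolding u_def v_def by (rule geodesic_segment_subpath[of "- real n" "real n"]) (use g in auto)
  have gs: "gromov_sequence u" "gromov_sequence v"
  proof -
    have "gromov_prod (g 0) (u i) (u j) = min (real i) (real j)"
      "gromov_prod (g 0) (v i) (v j) = min (real i) (real j)" for i j
      unfolding gromov_prod_def u_def v_def g by (auto simp: min_def)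
    moreover have "\<exists>N. \<forall>i\<ge>N. \<forall>j\<ge>N. M \<le> min (real i) (real j)" for M
    proof -
      have "M \<le> real i" if "nat \<lceil>M\<rceil> \<le> i" for i using that by linarith
      then show ?thesis by (intro exI[of _ "nat \<lceil>M\<rceil>"]) simp
    qed
    ultimately show "gromov_sequence u" "gromov_sequence v"
      by (simp_all add: gromov_sequenceI[of "g 0"])
  qed
  have up: "eventually (\<lambda>n. gromov_prod p (u n) (v n) \<le> R) sequentially" if R: "infdist p \<gamma> < R" for p R
  proof -
    obtain x where "x \<in> \<gamma>" "dist p x < R"
      by (rule infdist_le_obtain[OF order_refl _ R]) (use g(2) in auto)
    then obtain t where t: "dist p (g t) < R" using g(2) by blast
    have "gromov_prod p (u n) (v n) \<le> R" if "n \<ge> nat \<lceil>\<bar>t\<bar>\<rceil>" for n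
    proof -
      have "\<bar>t\<bar> \<le> real n" using that by linarith
      then have "g t \<in> g ` {- real n..real n}" by (intro imageI) auto
      then show ?thesis
        using gromov_prod_le_dist_segment[OF seg[of n], of "g t" p] t by linarith
    qed
    then show ?thesis unfolding eventually_sequentially by blast
  qed
  have low: "infdist p \<gamma> - 2 * (d + 1) \<le> gromov_prod p (u n) (v n)" for p n
  proof -
    obtain x where x: "x \<in> g ` {- real n..real n}" "dist p x \<le> gromov_prod p (u n) (v n) + 2 * (d + 1)"
      using slim_segment_near[OF assms(1-3) seg[of n], of p] by metis
    then have "infdist p \<gamma> \<le> dist p x" unfolding g(2) by (intro infdist_le) auto
    then show ?thesis using x(2) by simp
  qed
  show thesis by (rule that[OF gs]) (use up low in auto)
qed

text \<open>The value of \<^const>\<open>boundary_map\<close> is a union over representatives, so surjectivity directly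
  yields a representative whose image tends to the prescribed end.\<close>

lemma boundary_map_surj_lift:
  fixes f :: "'a::metric_space \<Rightarrow> 'b::metric_space"
  assumes "boundary_map f ` gromov_boundary TYPE('a) = gromov_boundary TYPE('b)"
    and u: "gromov_sequence u"
  obtains a where "gromov_sequence a" "(u, f \<circ> a) \<in> gromov_equiv"
proof -
  obtain \<xi> where \<xi>: "\<xi> \<in> gromov_boundary TYPE('a)" "boundary_map f \<xi> = gromov_equiv `` {u}"
    using assms(1) gromov_boundary_class[OF u] by (metis imageE)
  have "u \<in> boundary_map f \<xi>"
    unfolding \<xi>(2) using gromov_equiv_refl[OF u] by simp
  then obtain a where a: "a \<in> \<xi>" "(f \<circ> a, u) \<in> gromov_equiv"
    unfolding boundary_map_def by blast
  have "gromov_sequence a"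
    using a(1) \<xi>(1) by (auto elim!: gromov_boundaryE dest: gromov_equivD(2))
  then show thesis using that gromov_equiv_sym[OF a(2)] by blast
qed

text \<open>The line in \<open>Y\<close> for the points \<open>f p\<close> and \<open>f q\<close> is replaced by sequences \<open>f \<circ> a\<close> and \<open>f \<circ> b\<close> with
  the same ends, and the products of \<open>a\<close> and \<open>b\<close> at \<open>p\<close> and \<open>q\<close> are compared with those of their
  images. Each comparison costs a factor \<open>K\<close>, which gives the slope \<open>1 / (K * K)\<close>.\<close>

proposition geodesically_rich_imp_coarsely_rich:
  fixes f :: "'a::metric_space \<Rightarrow> 'b::metric_space"
  assumes hX: "gromov_hyperbolic TYPE('a)" and hY: "gromov_hyperbolic TYPE('b)"
    and rich: "geodesically_rich TYPE('b)" and f: "quasi_isometric_embedding f"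
    and surj: "boundary_map f ` gromov_boundary TYPE('a) = gromov_boundary TYPE('b)"
  obtains A R where "coarsely_rich TYPE('a) A R"
proof -
  obtain K C where qf: "qi_embedding_with K C f"
    using f unfolding quasi_isometric_embedding_def by blast
  then have KC: "1 \<le> K" "0 \<le> C" and fl: "\<And>x y. dist x y / K - C \<le> dist (f x) (f y)"
    unfolding qi_embedding_with_def by auto
  obtain H where H: "0 \<le> H"
    "\<And>p a b. gromov_prod (f p) (f a) (f b) \<le> K * gromov_prod p a b + H"
    "\<And>p a b. gromov_prod p a b \<le> K * gromov_prod (f p) (f a) (f b) + H"
    using qi_embedding_gromov_prod[OF hX hY qf] by metis
  obtain d where d: "0 \<le> d" "geodesic_space TYPE('b)" "slim_triangles TYPE('b) d"
    "four_point TYPE('b) (3 * (d + 1))"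
    using gromov_hyperbolicE[OF hY] by metis
  define h where "h = 3 * (d + 1)"
  have h: "four_point TYPE('b) h" "0 \<le> h" using d unfolding h_def by auto
  obtain r0 r1 r2 where r: "\<And>p q::'b. dist p q \<ge> r0 \<Longrightarrow>
      \<exists>\<gamma>. bi_infinite_geodesic \<gamma> \<and> infdist p \<gamma> < r1 \<and> \<bar>infdist q \<gamma> - dist p q\<bar> < r2"
    using rich unfolding geodesically_rich_def by blast
  define R1 where "R1 = K * (r1 + 2 * h) + H"
  define R2 where "R2 = (C + r2 + 2 * (d + 1) + 2 * h + H) / K"
  define R where "R = max (K * (r0 + C)) (max R1 R2)"
  have "\<exists>a b. gromov_sequence a \<and> gromov_sequence b \<and>
        eventually (\<lambda>n. gromov_prod p (a n) (b n) \<le> R) sequentially \<and>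
        eventually (\<lambda>n. dist p q / (K * K) - R \<le> gromov_prod q (a n) (b n)) sequentially"
    if pq: "R \<le> dist p q" for p q :: 'a
  proof -
    have "K * (r0 + C) \<le> dist p q" using pq unfolding R_def by simp
    then have "r0 \<le> dist p q / K - C" using KC by (simp add: field_simps)
    then have "r0 \<le> dist (f p) (f q)" using fl[of p q] by linarith
    then obtain \<gamma> where \<gamma>: "bi_infinite_geodesic \<gamma>" "infdist (f p) \<gamma> < r1"
      "\<bar>infdist (f q) \<gamma> - dist (f p) (f q)\<bar> < r2"
      using r by blast
    obtain u v where uv: "gromov_sequence u" "gromov_sequence v"
      "\<forall>p R. infdist p \<gamma> < R \<longrightarrow> eventually (\<lambda>n. gromov_prod p (u n) (v n) \<le> R) sequentially"
      "\<forall>p n. infdist p \<gamma> - 2 * (d + 1) \<le> gromov_prod p (u n) (v n)"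
      by (rule bi_infinite_geodesic_ends[OF d(2,3,1) \<gamma>(1)])
    obtain a where a: "gromov_sequence a" "(u, f \<circ> a) \<in> gromov_equiv"
      using boundary_map_surj_lift[OF surj uv(1)] .
    obtain b where b: "gromov_sequence b" "(v, f \<circ> b) \<in> gromov_equiv"
      using boundary_map_surj_lift[OF surj uv(2)] .
    have "eventually (\<lambda>n. gromov_prod (f p) ((f \<circ> a) n) ((f \<circ> b) n) \<le> r1 + 2 * h) sequentially"
      by (rule eventually_gromov_prod_le_equiv[OF h a(2) b(2) uv(3)[rule_format, OF \<gamma>(2)]])
    then have 1: "eventually (\<lambda>n. gromov_prod p (a n) (b n) \<le> R) sequentially"
    proof eventually_elim
      case (elim n)
      then have "K * gromov_prod (f p) (f (a n)) (f (b n)) \<le> K * (r1 + 2 * h)"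
        using KC by (intro mult_left_mono) auto
      then show ?case using H(3)[of p "a n" "b n"] unfolding R_def R1_def by linarith
    qed
    have "eventually (\<lambda>n. infdist (f q) \<gamma> - 2 * (d + 1) - 2 * h
        \<le> gromov_prod (f q) ((f \<circ> a) n) ((f \<circ> b) n)) sequentially"
      by (rule eventually_gromov_prod_ge_equiv[OF h a(2) b(2)]) (use uv(4) in simp)
    then have 2: "eventually (\<lambda>n. dist p q / (K * K) - R \<le> gromov_prod q (a n) (b n)) sequentially"
    proof eventually_elim
      case (elim n)
      have "dist p q / K \<le> K * gromov_prod q (a n) (b n) + (C + r2 + 2 * (d + 1) + 2 * h + H)"
        using elim \<gamma>(3) fl[of p q] H(2)[of q "a n" "b n"] by simp
      then have "dist p q / K / K \<le> (K * gromov_prod q (a n) (b n) + (C + r2 + 2 * (d + 1) + 2 * h + H)) / K"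
        using KC by (intro divide_right_mono) auto
      also have "\<dots> = gromov_prod q (a n) (b n) + R2"
        using KC unfolding R2_def by (simp add: add_divide_distrib)
      finally show ?case unfolding R_def by (simp add: max_def split: if_splits)
    qed
    show ?thesis using a(1) b(1) 1 2 by blast
  qed
  then have "coarsely_rich TYPE('a) (K * K) R"
    unfolding coarsely_rich_def using KC by auto
  then show thesis by (rule that)
qed

section \<open>Boundary rigidity\<close>

text \<open>The class of \<open>g \<circ> a\<close> is one of the members of the union defining the image of the class of
  \<open>a\<close>. It is nonempty because \<open>g \<circ> a\<close> is a Gromov sequence, and so it pins down this image.\<close>

lemma boundary_map_fixes_class:
  fixes g :: "'a::metric_space \<Rightarrow> 'a"
  assumes hyp: "gromov_hyperbolic TYPE('a)" and g: "qi_embedding_with K C g"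
    and fix_g: "\<forall>\<xi>\<in>gromov_boundary TYPE('a). boundary_map g \<xi> = \<xi>"
    and a: "gromov_sequence a"
  shows "(g \<circ> a, a) \<in> gromov_equiv"
proof -
  have "g \<circ> a \<in> boundary_map g (gromov_equiv `` {a})"
    unfolding boundary_map_def
    using gromov_equiv_refl[OF a] gromov_equiv_refl[OF qi_embedding_gromov_sequence[OF hyp hyp g a]]
    by blast
  then have "g \<circ> a \<in> gromov_equiv `` {a}"
    using fix_g gromov_boundary_class[OF a] by simp
  then show ?thesis using gromov_equiv_sym by blast
qed

text \<open>If \<open>x\<close> and \<open>g x\<close> were far apart, there would be a pair of boundary points whose connecting
  lines pass close to \<open>x\<close> but stay away from \<open>g x\<close>. Since \<open>g\<close> fixes the two boundary points, it
  maps these lines close to themselves, so they pass close to \<open>g x\<close> as well.\<close>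

proposition coarsely_rich_imp_boundary_rigid:
  assumes hyp: "gromov_hyperbolic TYPE('a::metric_space)" and rich: "coarsely_rich TYPE('a) A R"
  shows "boundary_rigid TYPE('a)"
  unfolding boundary_rigid_def
proof (intro allI impI)
  fix g :: "'a \<Rightarrow> 'a"
  assume g: "quasi_isometry g \<and> (\<forall>\<xi>\<in>gromov_boundary TYPE('a). boundary_map g \<xi> = \<xi>)"
  then obtain K C where qg: "qi_embedding_with K C g"
    unfolding quasi_isometry_def quasi_isometry_with_def by blast
  then have K: "1 \<le> K" unfolding qi_embedding_with_def by blast
  obtain H where H: "\<And>p a b. gromov_prod (g p) (g a) (g b) \<le> K * gromov_prod p a b + H"
    using qi_embedding_gromov_prod[OF hyp hyp qg] by metis
  obtain d where d: "0 \<le> d" "four_point TYPE('a) (3 * (d + 1))"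
    using gromov_hyperbolicE[OF hyp] by metis
  define h where "h = 3 * (d + 1)"
  have h: "four_point TYPE('a) h" "0 \<le> h" using d unfolding h_def by auto
  have A: "0 < A" using rich unfolding coarsely_rich_def by blast
  have "dist x (g x) \<le> max R (A * (K * R + H + 2 * h + R))" for x
  proof (cases "R \<le> dist x (g x)")
    case True
    then obtain a b where ab: "gromov_sequence a" "gromov_sequence b"
      "eventually (\<lambda>n. gromov_prod x (a n) (b n) \<le> R) sequentially"
      "eventually (\<lambda>n. dist x (g x) / A - R \<le> gromov_prod (g x) (a n) (b n)) sequentially"
      using rich unfolding coarsely_rich_def by blast
    from ab(3) have "eventually (\<lambda>n. gromov_prod (g x) ((g \<circ> a) n) ((g \<circ> b) n) \<le> K * R + H) sequentially"
    proof eventually_elim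
      case (elim n)
      then have "K * gromov_prod x (a n) (b n) \<le> K * R" using K by simp
      then show ?case using H[of x "a n" "b n"] by simp
    qed
    then have "eventually (\<lambda>n. gromov_prod (g x) (a n) (b n) \<le> K * R + H + 2 * h) sequentially"
      using eventually_gromov_prod_le_equiv[OF h boundary_map_fixes_class[OF hyp qg _ ab(1)]
          boundary_map_fixes_class[OF hyp qg _ ab(2)]] g by blast
    with ab(4) have "eventually (\<lambda>n::nat. dist x (g x) / A \<le> K * R + H + 2 * h + R) sequentially"
      by eventually_elim linarith
    then have "dist x (g x) / A \<le> K * R + H + 2 * h + R" by simp
    then show ?thesis using A by (simp add: field_simps le_max_iff_disj)
  qed simp
  then show "bdd_above (range (\<lambda>x. dist x (g x)))"
    by (intro bdd_aboveI) auto
qed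

section \<open>Branching along rays\<close>

lemma gromov_prod_complement:
  "gromov_prod q p x = dist p q - gromov_prod p q x"
  unfolding gromov_prod_def by (simp add: dist_commute field_simps)

lemma gromov_prod_change_base_eq:
  "gromov_prod w a b = dist w p + gromov_prod p a b - gromov_prod p w a - gromov_prod p w b"
  unfolding gromov_prod_def by (simp add: dist_commute field_simps)

lemma gromov_prod_self: "gromov_prod w x x = dist w x"
  unfolding gromov_prod_def by (simp add: dist_commute)

text \<open>If \<open>a\<close> and \<open>b\<close> fellow-travelled from \<open>p\<close> up to \<open>q\<close>, then \<open>b'\<close> would have to do the same,
  since a line from \<open>b\<close> to \<open>b'\<close> avoids \<open>q\<close>. But then \<open>b\<close> and \<open>b'\<close> would fellow-travel from \<open>p\<close>
  almost up to \<open>q\<close>, whereas a line from \<open>b\<close> to \<open>b'\<close> passes close to \<open>p\<close>.\<close>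

lemma branching:
  fixes p :: "'a::metric_space"
  assumes h: "four_point TYPE('a) h" "0 \<le> h"
    and a: "gromov_prod q p a \<le> h"
    and b: "gromov_prod p b b' \<le> R" "3 * h < gromov_prod q b b'"
    and pq: "R + 4 * h < dist p q"
  shows "gromov_prod p a b < dist p q"
proof (rule ccontr)
  assume "\<not> ?thesis"
  then have "dist p q - 2 * h \<le> gromov_prod p q b"
    using four_pointD[OF h(1), of p q a b] a gromov_prod_complement[of q p a] h(2) by linarith
  moreover from this have "gromov_prod q p b' \<le> 3 * h"
    using four_pointD[OF h(1), of q p b' b] b(2) gromov_prod_complement[of q p b]
      gromov_prod_commute[of q b b'] by linarith
  ultimately have "dist p q - 4 * h \<le> gromov_prod p b b'"
    using four_pointD[OF h(1), of p b q b'] gromov_prod_complement[of q p b'] h(2)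
      gromov_prod_commute[of p b q] by linarith
  then show False using b(1) pq by linarith
qed

text \<open>A line close to \<open>p\<close> cannot run towards \<open>w\<close> in both directions: for each single index the four
  point inequality bounds one of the two products. As \<open>a\<close> and \<open>b\<close> are Gromov sequences, a bound for
  one large index extends to all later ones.\<close>

lemma end_away_from_point:
  fixes a b :: "nat \<Rightarrow> 'a::metric_space"
  assumes h: "four_point TYPE('a) h" "0 \<le> h"
    and ab: "gromov_sequence a" "gromov_sequence b"
    and le: "eventually (\<lambda>n. gromov_prod p (a n) (b n) \<le> R) sequentially"
  shows "eventually (\<lambda>n. gromov_prod p w (a n) \<le> R + 2 * h) sequentially \<or>
    eventually (\<lambda>n. gromov_prod p w (b n) \<le> R + 2 * h) sequentially"
proof -
  have stable: "eventually (\<lambda>n. gromov_prod p w (c n) \<le> R + 2 * h) sequentially"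
    if N: "\<And>i j. N \<le> i \<Longrightarrow> N \<le> j \<Longrightarrow> R + 2 * h + 1 \<le> gromov_prod p (c i) (c j)"
      and k: "N \<le> k" "gromov_prod p w (c k) \<le> R + h" for c N k
  proof -
    have "gromov_prod p w (c n) \<le> R + 2 * h" if "N \<le> n" for n
      using four_pointD[OF h(1), of p w "c n" "c k"] N[OF that k(1)] k(2) h(2) by linarith
    then show ?thesis unfolding eventually_sequentially by blast
  qed
  obtain Na where Na: "\<And>i j. Na \<le> i \<Longrightarrow> Na \<le> j \<Longrightarrow> R + 2 * h + 1 \<le> gromov_prod p (a i) (a j)"
    using gromov_sequenceE[OF ab(1), of "R + 2 * h + 1" p] by metis
  obtain Nb where Nb: "\<And>i j. Nb \<le> i \<Longrightarrow> Nb \<le> j \<Longrightarrow> R + 2 * h + 1 \<le> gromov_prod p (b i) (b j)"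
    using gromov_sequenceE[OF ab(2), of "R + 2 * h + 1" p] by metis
  obtain N where N: "\<And>n. N \<le> n \<Longrightarrow> gromov_prod p (a n) (b n) \<le> R"
    using le unfolding eventually_sequentially by blast
  define k where "k = max N (max Na Nb)"
  have k: "N \<le> k" "Na \<le> k" "Nb \<le> k" unfolding k_def by auto
  have "gromov_prod p w (a k) \<le> R + h \<or> gromov_prod p w (b k) \<le> R + h"
    using four_pointD[OF h(1), of p "a k" w "b k"] N[OF k(1)] gromov_prod_commute[of p w "a k"]
    by linarith
  then show ?thesis
    using stable[of Na a k, OF Na k(2)] stable[of Nb b k, OF Nb k(3)] by blast
qed

text \<open>Towards the boundary point of \<open>a\<close>, take points \<open>p\<close> and \<open>q\<close> at distances \<open>T\<close> and \<open>T + L\<close>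
  from \<open>w\<close>. Richness yields a line that passes close to \<open>p\<close> and avoids \<open>q\<close>, and one of its ends
  is a boundary point whose connection to \<open>w\<close> leaves that of \<open>a\<close> at \<open>p\<close>, up to bounded error.\<close>

proposition coarsely_rich_branching:
  assumes geo: "geodesic_space TYPE('a::metric_space)" and h: "four_point TYPE('a) h" "0 \<le> h"
    and rich: "coarsely_rich TYPE('a) A R"
  obtains D where "0 \<le> D" "\<And>(w::'a) a T. gromov_sequence a \<Longrightarrow> 0 \<le> T \<Longrightarrow>
    \<exists>b. gromov_sequence b \<and>
      eventually (\<lambda>n. T - D \<le> gromov_prod w (a n) (b n)) sequentially \<and>
      eventually (\<lambda>n. gromov_prod w (a n) (b n) \<le> T + D) sequentially"
proof -
  have A: "0 < A" using rich unfolding coarsely_rich_def by blast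
  \<comment> \<open>The first part lets richness apply and makes room for the errors in the branching lemma; the
    last part keeps the line away from the second point in spite of the slope \<open>1 / A\<close>.\<close>
  define L where "L = \<bar>R\<bar> + 4 * h + 1 + A * (\<bar>R\<bar> + 3 * h + 1)"
  have "0 \<le> A * (\<bar>R\<bar> + 3 * h + 1)" using A h(2) by simp
  then have L: "0 \<le> L" "R \<le> L" "R + 4 * h < L" unfolding L_def using h(2) by linarith+
  have "(A * (\<bar>R\<bar> + 3 * h + 1)) / A \<le> L / A"
    using A h(2) unfolding L_def by (intro divide_right_mono) auto
  then have LA: "3 * h < L / A - R" using A by simp
  define D where "D = max L (\<bar>R\<bar> + 3 * h)"
  have "\<exists>b. gromov_sequence b \<and>
      eventually (\<lambda>n. T - D \<le> gromov_prod w (a n) (b n)) sequentially \<and>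
      eventually (\<lambda>n. gromov_prod w (a n) (b n) \<le> T + D) sequentially"
    if a: "gromov_sequence a" and T: "0 \<le> T" for w :: 'a and a T
  proof -
    obtain N where N: "\<And>i j. N \<le> i \<Longrightarrow> N \<le> j \<Longrightarrow> T + L \<le> gromov_prod w (a i) (a j)"
      using gromov_sequenceE[OF a, of "T + L" w] by metis
    have TL: "T + L \<le> dist w (a N)"
      using N[of N N] by (simp add: gromov_prod_self)
    obtain B where B: "geodesic_segment B w (a N)"
      using geo unfolding geodesic_space_def by metis
    obtain g where g: "g 0 = w" "g (dist w (a N)) = a N"
      "\<And>s t. s \<in> {0..dist w (a N)} \<Longrightarrow> t \<in> {0..dist w (a N)} \<Longrightarrow> dist (g s) (g t) = \<bar>s - t\<bar>"
      using geodesic_segmentE[OF B] by metis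
    have dg: "dist w (g s) = s" "dist (g s) (a N) = dist w (a N) - s" if "s \<in> {0..T + L}" for s
      using g(3)[of 0 s] g(3)[of s "dist w (a N)"] g(1,2) that TL by auto
    \<comment> \<open>The initial part of the segment stays close to the segments from \<open>w\<close> to later points.\<close>
    have on_ray: "gromov_prod (g s) w (a n) \<le> h" if s: "s \<in> {0..T + L}" and n: "N \<le> n" for s n
    proof -
      have "gromov_prod w (g s) (a N) = s"
        unfolding gromov_prod_def using dg[OF s] by (simp add: dist_commute)
      then have "s - h \<le> gromov_prod w (g s) (a n)"
        using four_pointD[OF h(1), of w "g s" "a N" "a n"] N[of N n] n s by auto
      then show ?thesis
        using gromov_prod_complement[of "g s" w "a n"] dg(1)[OF s] by linarith
    qed
    define p q where "p = g T" and "q = g (T + L)"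
    have pq: "dist w p = T" "dist p q = L"
      unfolding p_def q_def using dg(1)[of T] g(3)[of T "T + L"] T L TL by auto
    have wp: "gromov_prod p w (a n) \<le> h" if "N \<le> n" for n
      unfolding p_def using on_ray[of T n] that T L by auto
    have qp: "gromov_prod q p (a n) \<le> h" if "N \<le> n" for n
    proof -
      have "gromov_prod q p (a n) \<le> gromov_prod q w (a n)"
        using pq dg(1)[of "T + L"] dist_triangle[of w "a n" p] T L
        unfolding gromov_prod_def q_def by (simp add: dist_commute)
      then show ?thesis
        unfolding q_def using on_ray[of "T + L" n] that T L by auto
    qed
    obtain b b' where b: "gromov_sequence b" "gromov_sequence b'"
      "eventually (\<lambda>n. gromov_prod p (b n) (b' n) \<le> R) sequentially"
      "eventually (\<lambda>n. L / A - R \<le> gromov_prod q (b n) (b' n)) sequentially"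
      "eventually (\<lambda>n. gromov_prod p w (b n) \<le> R + 2 * h) sequentially"
    proof -
      obtain c c' where c: "gromov_sequence c" "gromov_sequence c'"
        "eventually (\<lambda>n. gromov_prod p (c n) (c' n) \<le> R) sequentially"
        "eventually (\<lambda>n. L / A - R \<le> gromov_prod q (c n) (c' n)) sequentially"
        using rich L(2) pq(2) unfolding coarsely_rich_def by metis
      have c': "eventually (\<lambda>n. gromov_prod p (c' n) (c n) \<le> R) sequentially"
        "eventually (\<lambda>n. L / A - R \<le> gromov_prod q (c' n) (c n)) sequentially"
        using c(3,4) by (simp_all add: gromov_prod_commute)
      show thesis
        using end_away_from_point[OF h c(1,2,3), of w]
      proof
        assume "eventually (\<lambda>n. gromov_prod p w (c n) \<le> R + 2 * h) sequentially"
        then show thesis by (rule that[OF c])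
      next
        assume "eventually (\<lambda>n. gromov_prod p w (c' n) \<le> R + 2 * h) sequentially"
        then show thesis by (rule that[OF c(2,1) c'])
      qed
    qed
    have "eventually (\<lambda>n. T - D \<le> gromov_prod w (a n) (b n) \<and>
        gromov_prod w (a n) (b n) \<le> T + D) sequentially"
      using b(3,4,5) eventually_ge_at_top[of N]
    proof eventually_elim
      case (elim n)
      have "gromov_prod p (a n) (b n) < L"
        using branching[OF h qp[OF elim(4)] elim(1)] elim(2) LA L(3) unfolding pq(2) by linarith
      then show ?case
        using gromov_prod_change_base_eq[of w "a n" "b n" p] elim(3) wp[OF elim(4)] pq(1)
          gromov_prod_nonneg[of p "a n" "b n"] gromov_prod_nonneg[of p w "a n"]
          gromov_prod_nonneg[of p w "b n"]
        unfolding D_def by linarith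
    qed
    then show ?thesis using b(1) by (auto simp: eventually_conj_iff)
  qed
  moreover have "0 \<le> D" unfolding D_def using L by simp
  ultimately show thesis using that by blast
qed

section \<open>Visual metrics\<close>

text \<open>This is Frink's argument. A chain is cut at the link where half of the total length is
  reached. By induction, the distances between the end points of the two remaining chains are
  at most the total length, and so is the length of the removed link. Putting the three pieces
  together costs a factor \<open>K * K\<close>, which the constant \<open>2\<close> absorbs.\<close>

lemma quasi_ultrametric_chain:
  fixes \<rho> :: "'z \<Rightarrow> 'z \<Rightarrow> real" and c :: "nat \<Rightarrow> 'z"
  assumes nonneg: "\<And>x y. 0 \<le> \<rho> x y" and refl: "\<And>x. x \<in> Z \<Longrightarrow> \<rho> x x = 0"
    and ultra: "\<And>x y z. x \<in> Z \<Longrightarrow> y \<in> Z \<Longrightarrow> z \<in> Z \<Longrightarrow> \<rho> x z \<le> K * max (\<rho> x y) (\<rho> y z)"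
    and K: "1 \<le> K" "K * K \<le> 2"
    and "m \<le> n" "\<And>i. i \<le> n \<Longrightarrow> c i \<in> Z"
  shows "\<rho> (c m) (c n) \<le> 2 * (\<Sum>i=m..<n. \<rho> (c i) (c (Suc i)))"
  using assms(6,7)
proof (induction "n - m" arbitrary: m n rule: less_induct)
  case less
  define S where "S i j = (\<Sum>k=i..<j. \<rho> (c k) (c (Suc k)))" for i j
  have S_nonneg: "0 \<le> S i j" for i j
    unfolding S_def by (intro sum_nonneg nonneg)
  have S_split: "S i j + S j k = S i k" if "i \<le> j" "j \<le> k" for i j k
    unfolding S_def using that by (rule sum.atLeastLessThan_concat)
  show ?case
  proof (cases "m = n")
    case True
    then show ?thesis using refl less.prems by simp
  next
    case False
    then have mn: "m < n" using less.prems by simp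
    define P where "P k \<longleftrightarrow> m \<le> k \<and> k < n \<and> S m k \<le> S m n / 2" for k
    define k where "k = (GREATEST k. P k)"
    have "P m" unfolding P_def using mn S_nonneg[of m n] by (simp add: S_def)
    moreover have bd: "\<And>y. P y \<Longrightarrow> y \<le> n" unfolding P_def by simp
    ultimately have Pk: "P k" unfolding k_def by (rule GreatestI_nat)
    then have k: "m \<le> k" "k < n" "S m k \<le> S m n / 2" unfolding P_def by auto
    have rest: "S (Suc k) n \<le> S m n / 2"
    proof (cases "Suc k = n")
      case True
      then show ?thesis using S_nonneg[of m n] by (simp add: S_def)
    next
      case False
      have "\<not> P (Suc k)"
        using Greatest_le_nat[of P "Suc k" n] bd unfolding k_def[symmetric] by auto
      then have "S m n / 2 < S m (Suc k)" unfolding P_def using k False by auto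
      then show ?thesis using S_split[of m "Suc k" n] k by simp
    qed
    have "\<rho> (c m) (c k) \<le> 2 * S m k" "\<rho> (c (Suc k)) (c n) \<le> 2 * S (Suc k) n"
      unfolding S_def using k less.prems by (intro less.hyps; simp)+
    then have 1: "\<rho> (c m) (c k) \<le> S m n" "\<rho> (c (Suc k)) (c n) \<le> S m n"
      using k(3) rest by auto
    have "S k (Suc k) = \<rho> (c k) (c (Suc k))" by (simp add: S_def)
    then have 2: "\<rho> (c k) (c (Suc k)) \<le> S m n"
      using S_split[of m k "Suc k"] S_split[of m "Suc k" n] S_nonneg[of m k] S_nonneg[of "Suc k" n] k
      by linarith
    have mem: "c m \<in> Z" "c k \<in> Z" "c (Suc k) \<in> Z" "c n \<in> Z"
      using less.prems k by auto
    have KS: "S m n \<le> K * S m n" using mult_right_mono[OF K(1) S_nonneg[of m n]] by simp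
    have "\<rho> (c m) (c (Suc k)) \<le> K * max (\<rho> (c m) (c k)) (\<rho> (c k) (c (Suc k)))"
      by (rule ultra) (use mem in auto)
    also have "\<dots> \<le> K * S m n" using K(1) 1 2 by (intro mult_left_mono) auto
    finally have 3: "\<rho> (c m) (c (Suc k)) \<le> K * S m n" .
    have "\<rho> (c m) (c n) \<le> K * max (\<rho> (c m) (c (Suc k))) (\<rho> (c (Suc k)) (c n))"
      by (rule ultra) (use mem in auto)
    also have "\<dots> \<le> K * (K * S m n)" using K(1) 1(2) 3 KS by (intro mult_left_mono) auto
    also have "\<dots> \<le> 2 * S m n"
      using mult_right_mono[OF K(2) S_nonneg[of m n]] by (simp add: mult.assoc)
    finally show ?thesis unfolding S_def .
  qed
qed

lemma le_boundary_gromov_prodI: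
  assumes "\<And>x y. x \<in> \<xi> \<Longrightarrow> y \<in> \<zeta> \<Longrightarrow> eventually (\<lambda>n. c \<le> gromov_prod w (x n) (y n)) sequentially"
  shows "ereal c \<le> boundary_gromov_prod w \<xi> \<zeta>"
  unfolding boundary_gromov_prod_def
  by (rule INF_greatest) (auto intro!: Liminf_bounded dest: assms)

lemma boundary_gromov_prod_leI:
  assumes "x \<in> \<xi>" "y \<in> \<zeta>" "eventually (\<lambda>n. gromov_prod w (x n) (y n) \<le> c) sequentially"
  shows "boundary_gromov_prod w \<xi> \<zeta> \<le> ereal c"
proof -
  have "boundary_gromov_prod w \<xi> \<zeta> \<le> liminf (\<lambda>i. ereal (gromov_prod w (x i) (y i)))"
    unfolding boundary_gromov_prod_def using assms(1,2) by (intro INF_lower2[of "(x, y)"]) auto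
  also have "\<dots> \<le> limsup (\<lambda>i. ereal (gromov_prod w (x i) (y i)))"
    by (rule Liminf_le_Limsup) simp
  also have "\<dots> \<le> ereal c"
    by (rule Limsup_bounded) (use assms(3) in simp)
  finally show ?thesis .
qed

lemma less_boundary_gromov_prodD:
  assumes "ereal c < boundary_gromov_prod w \<xi> \<zeta>" "x \<in> \<xi>" "y \<in> \<zeta>"
  shows "eventually (\<lambda>n. c < gromov_prod w (x n) (y n)) sequentially"
proof -
  have "boundary_gromov_prod w \<xi> \<zeta> \<le> liminf (\<lambda>i. ereal (gromov_prod w (x i) (y i)))"
    unfolding boundary_gromov_prod_def using assms(2,3) by (intro INF_lower2[of "(x, y)"]) auto
  then have "ereal c < liminf (\<lambda>i. ereal (gromov_prod w (x i) (y i)))"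
    using assms(1) by simp
  then show ?thesis using less_LiminfD by fastforce
qed

lemma boundary_gromov_prod_nonneg: "0 \<le> boundary_gromov_prod w \<xi> \<zeta>"
  unfolding zero_ereal_def by (rule le_boundary_gromov_prodI) (simp add: gromov_prod_nonneg)

lemma visual_weight_nonneg: "0 \<le> visual_weight w \<epsilon> \<xi> \<zeta>"
  by (simp add: visual_weight_def)

lemma visual_weight_leI:
  assumes "0 < \<epsilon>" "ereal c \<le> boundary_gromov_prod w \<xi> \<zeta>"
  shows "visual_weight w \<epsilon> \<xi> \<zeta> \<le> exp (- \<epsilon> * c)"
  using assms boundary_gromov_prod_nonneg[of w \<xi> \<zeta>]
  by (cases "boundary_gromov_prod w \<xi> \<zeta>") (auto simp: visual_weight_def)

lemma visual_weight_geI: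
  assumes "0 < \<epsilon>" "boundary_gromov_prod w \<xi> \<zeta> \<le> ereal c"
  shows "exp (- \<epsilon> * c) \<le> visual_weight w \<epsilon> \<xi> \<zeta>"
  using assms boundary_gromov_prod_nonneg[of w \<xi> \<zeta>]
  by (cases "boundary_gromov_prod w \<xi> \<zeta>") (auto simp: visual_weight_def)

lemma visual_weight_lessD:
  assumes "0 < \<epsilon>" "visual_weight w \<epsilon> \<xi> \<zeta> < exp (- \<epsilon> * c)"
  shows "ereal c < boundary_gromov_prod w \<xi> \<zeta>"
  using assms visual_weight_geI[of \<epsilon> w \<xi> \<zeta> c] by (meson linorder_not_le)

text \<open>The points at distance \<open>t\<close> from \<open>w\<close> on segments from \<open>w\<close> to \<open>x\<close>, \<open>y\<close> and \<open>z\<close> are compared, where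
  \<open>t\<close> is the minimum in the four point inequality. It matters that the constant is exactly \<open>\<delta>\<close>: the
  admissible range of visual parameters is tied to it.\<close>

lemma thin_triangles_imp_four_point:
  assumes geo: "geodesic_space TYPE('a::metric_space)" and thin: "delta_thin_triangles TYPE('a) \<delta>"
  shows "four_point TYPE('a) \<delta>"
  unfolding four_point_def
proof (intro allI)
  fix w x y z :: 'a
  define t where "t = min (gromov_prod w x y) (gromov_prod w y z)"
  have t: "0 \<le> t" "t \<le> dist w x" "t \<le> dist w y" "t \<le> dist w z"
    using gromov_prod_nonneg[of w x y] gromov_prod_nonneg[of w y z] gromov_prod_le_dist[of w x y]
      gromov_prod_le_dist[of w y z] gromov_prod_le_dist[of w z y] gromov_prod_commute[of w y z]
    unfolding t_def by linarith+
  have pt: "\<exists>A p. geodesic_segment A w v \<and> p \<in> A \<and> dist w p = t \<and> dist p v = dist w v - t"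
    if v: "t \<le> dist w v" for v
  proof -
    obtain A where A: "geodesic_segment A w v"
      using geo unfolding geodesic_space_def by metis
    obtain g where g: "g 0 = w"
      "\<And>s t. s \<in> {0..dist w v} \<Longrightarrow> t \<in> {0..dist w v} \<Longrightarrow> dist (g s) (g t) = \<bar>s - t\<bar>"
      "A = g ` {0..dist w v}"
      using geodesic_segmentE[OF A] by metis
    have "g t \<in> A" "dist w (g t) = t"
      using g(2)[of 0 t] g(1,3) t(1) v by auto
    then show ?thesis using A geodesic_segment_dist[OF A, of "g t"] by force
  qed
  obtain A px where x: "geodesic_segment A w x" "px \<in> A" "dist w px = t" "dist px x = dist w x - t"
    using pt[OF t(2)] by blast
  obtain B py where y: "geodesic_segment B w y" "py \<in> B" "dist w py = t"
    using pt[OF t(3)] by blast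
  obtain C pz where z: "geodesic_segment C w z" "pz \<in> C" "dist w pz = t" "dist pz z = dist w z - t"
    using pt[OF t(4)] by blast
  have "dist px py \<le> \<delta>" "dist py pz \<le> \<delta>"
    using thin x y z unfolding delta_thin_triangles_def t_def by (metis min.cobounded1 min.cobounded2)+
  then have "dist x z \<le> dist w x + dist w z - 2 * t + 2 * \<delta>"
    using x(4) z(4) dist_triangle[of x z px] dist_triangle[of px z py] dist_triangle[of py z pz]
    by (simp add: dist_commute)
  then show "min (gromov_prod w x y) (gromov_prod w y z) - \<delta> \<le> gromov_prod w x z"
    unfolding t_def[symmetric] by (simp add: gromov_prod_def dist_commute field_simps)
qed

text \<open>Representatives of the same class have Gromov products tending to infinity, so the case
  distinction in \<^const>\<open>visual_weight\<close> applies.\<close>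

lemma visual_weight_self:
  fixes \<xi> :: "(nat \<Rightarrow> 'a::metric_space) set"
  assumes h: "four_point TYPE('a) h" "0 \<le> h" and \<xi>: "\<xi> \<in> gromov_boundary TYPE('a)"
  shows "visual_weight w \<epsilon> \<xi> \<xi> = 0"
proof -
  obtain a where a: "gromov_sequence a" "\<xi> = gromov_equiv `` {a}"
    using gromov_boundaryE[OF \<xi>] .
  have "ereal c \<le> boundary_gromov_prod w \<xi> \<xi>" for c
  proof (rule le_boundary_gromov_prodI)
    fix x y assume "x \<in> \<xi>" "y \<in> \<xi>"
    then have xy: "(a, x) \<in> gromov_equiv" "(a, y) \<in> gromov_equiv" using a by auto
    have "eventually (\<lambda>n. c + 2 * h - 2 * h \<le> gromov_prod w (x n) (y n)) sequentially"
      by (rule eventually_gromov_prod_ge_equiv[OF h xy gromov_equivD(3)[OF gromov_equiv_refl[OF a(1)]]])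
    then show "eventually (\<lambda>n. c \<le> gromov_prod w (x n) (y n)) sequentially" by simp
  qed
  then have "boundary_gromov_prod w \<xi> \<xi> = \<infinity>" by (simp add: ereal_top)
  then show ?thesis by (simp add: visual_weight_def)
qed

text \<open>This is the four point inequality in the limit: its additive error \<open>h\<close> turns into the factor
  \<open>exp (\<epsilon> * h)\<close> on exponentiation. Testing with all \<open>s\<close> above the maximum avoids a separate
  treatment of infinite Gromov products.\<close>

lemma visual_weight_quasi_ultrametric:
  fixes \<xi> \<eta> \<zeta> :: "(nat \<Rightarrow> 'a::metric_space) set"
  assumes h: "four_point TYPE('a) h" and \<epsilon>: "0 < \<epsilon>" and \<eta>: "\<eta> \<in> gromov_boundary TYPE('a)"
  shows "visual_weight w \<epsilon> \<xi> \<zeta> \<le>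
    exp (\<epsilon> * h) * max (visual_weight w \<epsilon> \<xi> \<eta>) (visual_weight w \<epsilon> \<eta> \<zeta>)" (is "?W \<le> ?K * ?M")
proof -
  obtain y where y: "y \<in> \<eta>"
    using \<eta> by (elim gromov_boundaryE) (auto dest: gromov_equiv_refl)
  have "?W / ?K \<le> s" if s: "?M < s" for s
  proof -
    have "0 < s" using s visual_weight_nonneg[of w \<epsilon> \<xi> \<eta>] by linarith
    define c where "c = - ln s / \<epsilon>"
    have sc: "s = exp (- \<epsilon> * c)" using \<open>0 < s\<close> \<epsilon> by (simp add: c_def)
    have c: "ereal c < boundary_gromov_prod w \<xi> \<eta>" "ereal c < boundary_gromov_prod w \<eta> \<zeta>"
      using s unfolding sc by (auto intro: visual_weight_lessD[OF \<epsilon>])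
    have "ereal (c - h) \<le> boundary_gromov_prod w \<xi> \<zeta>"
    proof (rule le_boundary_gromov_prodI)
      fix x z assume "x \<in> \<xi>" "z \<in> \<zeta>"
      then have "eventually (\<lambda>n. c < gromov_prod w (x n) (y n)) sequentially"
        "eventually (\<lambda>n. c < gromov_prod w (y n) (z n)) sequentially"
        using less_boundary_gromov_prodD c y by blast+
      then show "eventually (\<lambda>n. c - h \<le> gromov_prod w (x n) (z n)) sequentially"
      proof eventually_elim
        case (elim n)
        then show ?case using four_pointD[OF h, of w "x n" "y n" "z n"] by linarith
      qed
    qed
    then have "?W \<le> exp (- \<epsilon> * (c - h))" by (rule visual_weight_leI[OF \<epsilon>])
    also have "\<dots> = ?K * s" unfolding sc by (simp add: exp_add[symmetric] algebra_simps)
    finally show ?thesis by (simp add: field_simps)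
  qed
  then have "?W / ?K \<le> ?M" by (rule dense_ge)
  then show ?thesis by (simp add: field_simps)
qed

lemma visual_dist_le_weight:
  fixes \<xi> \<zeta> :: "(nat \<Rightarrow> 'a::metric_space) set"
  assumes "\<xi> \<in> gromov_boundary TYPE('a)" "\<zeta> \<in> gromov_boundary TYPE('a)"
  shows "visual_dist w \<epsilon> \<xi> \<zeta> \<le> visual_weight w \<epsilon> \<xi> \<zeta>"
  unfolding visual_dist_def
proof (rule cInf_lower)
  show "visual_weight w \<epsilon> \<xi> \<zeta> \<in> {\<Sum>i=1..n. visual_weight w \<epsilon> (c (i - 1)) (c i) | (n::nat) c.
      c 0 = \<xi> \<and> c n = \<zeta> \<and> (\<forall>i\<le>n. c i \<in> gromov_boundary TYPE('a))}"
    by (rule CollectI, rule exI[of _ "1::nat"], rule exI[of _ "\<lambda>i. if i = 0 then \<xi> else \<zeta>"])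
      (use assms in auto)
  show "bdd_below {\<Sum>i=1..n. visual_weight w \<epsilon> (c (i - 1)) (c i) | (n::nat) c.
      c 0 = \<xi> \<and> c n = \<zeta> \<and> (\<forall>i\<le>n. c i \<in> gromov_boundary TYPE('a))}"
    by (rule bdd_belowI[of _ 0]) (auto intro!: sum_nonneg visual_weight_nonneg)
qed

text \<open>The bound on the visual parameter makes the constant in the quasi-ultrametric inequality at
  most \<open>exp (1 / 5)\<close>, whose square is less than \<open>2\<close>.\<close>

lemma half_weight_le_visual_dist:
  fixes \<xi> \<zeta> :: "(nat \<Rightarrow> 'a::metric_space) set"
  assumes \<epsilon>: "visual_parameter TYPE('a) \<epsilon>"
    and mem: "\<xi> \<in> gromov_boundary TYPE('a)" "\<zeta> \<in> gromov_boundary TYPE('a)"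
  shows "visual_weight w \<epsilon> \<xi> \<zeta> / 2 \<le> visual_dist w \<epsilon> \<xi> \<zeta>"
  unfolding visual_dist_def
proof (rule cInf_greatest)
  show "{\<Sum>i=1..n. visual_weight w \<epsilon> (c (i - 1)) (c i) | (n::nat) c.
      c 0 = \<xi> \<and> c n = \<zeta> \<and> (\<forall>i\<le>n. c i \<in> gromov_boundary TYPE('a))} \<noteq> {}"
    by (simp, rule exI[of _ "1::nat"], rule exI[of _ "\<lambda>i. if i = 0 then \<xi> else \<zeta>"])
      (use mem in auto)
  obtain \<delta> where \<delta>: "0 < \<delta>" "delta_hyperbolic TYPE('a) \<delta>" "delta_thin_triangles TYPE('a) \<delta>"
    "0 < \<epsilon>" "\<epsilon> < 1 / (5 * \<delta>)"
    using \<epsilon> unfolding visual_parameter_def by auto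
  then have h: "four_point TYPE('a) \<delta>"
    by (intro thin_triangles_imp_four_point) (auto simp: delta_hyperbolic_def)
  define K where "K = exp (\<epsilon> * \<delta>)"
  have "\<epsilon> * \<delta> < 1 / 5" using \<delta> by (simp add: field_simps)
  then have "\<epsilon> * \<delta> + \<epsilon> * \<delta> \<le> 1 / 2" by linarith
  then have "K * K \<le> exp (1 / 2)" unfolding K_def by (simp only: exp_add[symmetric] exp_le_cancel_iff)
  also have "\<dots> \<le> (2::real)" using exp_bound_half[of "1 / 2 :: real"] by simp
  finally have K: "1 \<le> K" "K * K \<le> 2" unfolding K_def using \<delta> by auto
  fix v
  assume "v \<in> {\<Sum>i=1..n. visual_weight w \<epsilon> (c (i - 1)) (c i) | (n::nat) c.
      c 0 = \<xi> \<and> c n = \<zeta> \<and> (\<forall>i\<le>n. c i \<in> gromov_boundary TYPE('a))}"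
  then obtain n :: nat and c where c: "v = (\<Sum>i=1..n. visual_weight w \<epsilon> (c (i - 1)) (c i))"
    "c 0 = \<xi>" "c n = \<zeta>" "\<forall>i\<le>n. c i \<in> gromov_boundary TYPE('a)"
    by blast
  have "visual_weight w \<epsilon> (c 0) (c n) \<le> 2 * (\<Sum>i=0..<n. visual_weight w \<epsilon> (c i) (c (Suc i)))"
    by (rule quasi_ultrametric_chain[where K = K and Z = "gromov_boundary TYPE('a)"])
      (use visual_weight_nonneg visual_weight_self[OF h] visual_weight_quasi_ultrametric[OF h \<delta>(4)]
        K c(4) \<delta>(1) in \<open>auto simp: K_def\<close>)
  also have "(\<Sum>i=0..<n. visual_weight w \<epsilon> (c i) (c (Suc i))) = v"
    unfolding c(1) by (simp add: sum.atLeast1_atMost_eq atLeast0LessThan)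
  finally show "visual_weight w \<epsilon> \<xi> \<zeta> / 2 \<le> v" using c by simp
qed

section \<open>Uniform perfectness\<close>

text \<open>The radius \<open>r\<close> is translated to \<open>T = D - ln r / \<epsilon>\<close>. The summand \<open>D\<close> makes up for the error in the
  position of the branching point, so that the new boundary point is at distance at most \<open>r\<close>; on
  the other side the error is absorbed by \<open>S\<close>.\<close>

proposition coarsely_rich_imp_uniformly_perfect_boundary:
  assumes hyp: "gromov_hyperbolic TYPE('a::metric_space)" and rich: "coarsely_rich TYPE('a) A R"
  shows "uniformly_perfect_boundary TYPE('a)"
  unfolding uniformly_perfect_boundary_def
proof (intro allI impI)
  fix w :: 'a and \<epsilon>
  assume vp: "visual_parameter TYPE('a) \<epsilon>"
  then have \<epsilon>: "0 < \<epsilon>" unfolding visual_parameter_def by blast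
  obtain d where d: "0 \<le> d" "geodesic_space TYPE('a)" "four_point TYPE('a) (3 * (d + 1))"
    using gromov_hyperbolicE[OF hyp] by metis
  define h where "h = 3 * (d + 1)"
  have h: "four_point TYPE('a) h" "0 \<le> h" using d unfolding h_def by auto
  obtain D0 where D0: "0 \<le> D0" "\<And>(w::'a) a T. gromov_sequence a \<Longrightarrow> 0 \<le> T \<Longrightarrow>
    \<exists>b. gromov_sequence b \<and>
      eventually (\<lambda>n. T - D0 \<le> gromov_prod w (a n) (b n)) sequentially \<and>
      eventually (\<lambda>n. gromov_prod w (a n) (b n) \<le> T + D0) sequentially"
    using coarsely_rich_branching[OF d(2) h rich] by metis
  define D where "D = D0 + 2 * h"
  have D: "0 \<le> D" unfolding D_def using D0(1) h(2) by simp
  define S where "S = 4 * exp (2 * \<epsilon> * D)"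
  have "1 \<le> exp (2 * \<epsilon> * D)" using D \<epsilon> by simp
  then have S: "1 \<le> S" unfolding S_def by linarith
  have "\<exists>\<zeta>\<in>gromov_boundary TYPE('a). r / S < visual_dist w \<epsilon> \<xi> \<zeta> \<and> visual_dist w \<epsilon> \<xi> \<zeta> \<le> r"
    if \<xi>: "\<xi> \<in> gromov_boundary TYPE('a)" and r: "0 < r" "r \<le> 1" for \<xi> r
  proof -
    obtain a where a: "gromov_sequence a" "\<xi> = gromov_equiv `` {a}"
      using gromov_boundaryE[OF \<xi>] .
    define T where "T = D - ln r / \<epsilon>"
    have "ln r \<le> 0" using r by simp
    then have "ln r / \<epsilon> \<le> 0" using \<epsilon> by (simp add: divide_nonpos_pos)
    then have T: "0 \<le> T" unfolding T_def using D by simp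
    obtain b where b: "gromov_sequence b"
      "eventually (\<lambda>n. T - D0 \<le> gromov_prod w (a n) (b n)) sequentially"
      "eventually (\<lambda>n. gromov_prod w (a n) (b n) \<le> T + D0) sequentially"
      using D0(2)[OF a(1) T] by blast
    define \<zeta> where "\<zeta> = gromov_equiv `` {b}"
    have \<zeta>: "\<zeta> \<in> gromov_boundary TYPE('a)"
      unfolding \<zeta>_def by (rule gromov_boundary_class[OF b(1)])
    have "ereal (T - D) \<le> boundary_gromov_prod w \<xi> \<zeta>"
    proof (rule le_boundary_gromov_prodI)
      fix x y assume "x \<in> \<xi>" "y \<in> \<zeta>"
      then have "(a, x) \<in> gromov_equiv" "(b, y) \<in> gromov_equiv" using a \<zeta>_def by auto
      then show "eventually (\<lambda>n. T - D \<le> gromov_prod w (x n) (y n)) sequentially"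
        using eventually_gromov_prod_ge_equiv[OF h _ _ b(2)] unfolding D_def by (simp add: algebra_simps)
    qed
    then have "visual_weight w \<epsilon> \<xi> \<zeta> \<le> exp (- \<epsilon> * (T - D))"
      by (rule visual_weight_leI[OF \<epsilon>])
    also have "\<dots> = r" unfolding T_def using \<epsilon> r by simp
    finally have up: "visual_dist w \<epsilon> \<xi> \<zeta> \<le> r"
      using visual_dist_le_weight[OF \<xi> \<zeta>, of w \<epsilon>] by simp
    have "boundary_gromov_prod w \<xi> \<zeta> \<le> ereal (T + D0)"
      by (rule boundary_gromov_prod_leI[OF _ _ b(3)])
        (auto simp: a(2) \<zeta>_def intro: gromov_equiv_refl a(1) b(1))
    also have "\<dots> \<le> ereal (T + D)" unfolding D_def using h(2) by simp
    finally have "exp (- \<epsilon> * (T + D)) \<le> visual_weight w \<epsilon> \<xi> \<zeta>"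
      by (rule visual_weight_geI[OF \<epsilon>])
    moreover have "exp (- \<epsilon> * (T + D)) = r / exp (2 * \<epsilon> * D)"
    proof -
      have "- \<epsilon> * (T + D) = ln r - 2 * \<epsilon> * D" unfolding T_def using \<epsilon> by (simp add: field_simps)
      then show ?thesis using r by (simp only: exp_diff exp_ln)
    qed
    ultimately have "r / exp (2 * \<epsilon> * D) / 2 \<le> visual_weight w \<epsilon> \<xi> \<zeta> / 2" by simp
    also have "\<dots> \<le> visual_dist w \<epsilon> \<xi> \<zeta>"
      by (rule half_weight_le_visual_dist[OF vp \<xi> \<zeta>])
    finally have "r / exp (2 * \<epsilon> * D) / 2 \<le> visual_dist w \<epsilon> \<xi> \<zeta>" .
    moreover have "r / S < r / exp (2 * \<epsilon> * D) / 2"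
      unfolding S_def using r by (simp add: field_simps)
    ultimately show ?thesis using up \<zeta> by force
  qed
  then show "uniformly_perfect (gromov_boundary TYPE('a)) (visual_dist w \<epsilon>)"
    unfolding uniformly_perfect_def using S by (intro exI[of _ S] conjI exI[of _ "1::real"]) auto
qed

theorem corollary1p12:
  fixes f :: "'a::metric_space \<Rightarrow> 'b::metric_space"
  assumes "proper_metric_space TYPE('a)"
    and "geodesic_space TYPE('a)"
    and "gromov_hyperbolic TYPE('a)"
    and "geodesically_rich TYPE('b)"
    and "gromov_hyperbolic TYPE('b)"
    and "quasi_isometric_embedding f"
    and "bij_betw (boundary_map f) (gromov_boundary TYPE('a)) (gromov_boundary TYPE('b))"
  shows "boundary_rigid TYPE('a) \<and> uniformly_perfect_boundary TYPE('a)"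
proof -
  obtain A R where "coarsely_rich TYPE('a) A R"
    using geodesically_rich_imp_coarsely_rich[OF assms(3,5,4,6) bij_betw_imp_surj_on[OF assms(7)]]
    by metis
  then show ?thesis
    using coarsely_rich_imp_boundary_rigid coarsely_rich_imp_uniformly_perfect_boundary assms(3)
    by blast
qed

end
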